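(* For all Borel subsets $A,B\subset[0,1]^{\mathbb{N}}$, the set $A\,\square\,B$ (the event that $A$ and $B$ occur for finite disjoint sets of reasons) is Lebesgue measurable, and $$\lambda(A\,\square\,B)\le m(A)\,m(B).$$ For every integer $r\ge2$ and all Borel subsets $A_1,\dots,A_r\subset[0,1]^{\mathbb{N}}$, the set $\square_{i=1}^rA_i$ is Lebesgue measurable, and $$\lambda\Big(\square_{i=1}^rA_i\Big)\le\prod_{i=1}^r m(A_i).$$
   Context: Let $S=[0,1]$ and $\mathbb{N}=\{1,2,\dots\}$. For $\omega\in S^{\mathbb{N}}$ and $K\subset\mathbb{N}$, let $\mathrm{Cyl}(K,\omega)=\{\overline\omega\in S^{\mathbb{N}}:\overline\omega_i=\omega_i\text{ for all }i\in K\}$. For $A\subset S^{\mathbb{N}}$ let $[A]_K=\{\omega\in S^{\mathbb{N}}:\mathrm{Cyl}(K,\omega)\subset A\}$. For $A,B\subset S^{\mathbb{N}}$ define $A\,\square\,B=\bigcup[A]_J\cap[B]_K$, the union being over all pairs of finite disjoint subsets $J,K\subset\mathbb{N}$. For $A_1,\dots,A_r\subset S^{\mathbb{N}}$ define $\square_{i=1}^rA_i=\bigcup\bigcap_{i=1}^r[A_i]_{J_i}$, the union being over all $r$-tuples of finite, pairwise disjoint (possibly empty) subsets $J_1,\dots,J_r\subset\mathbb{N}$. $m$ denotes Lebesgue measure on the Borel subsets of $[0,1]^{\mathbb{N}}$ (the countable product of the uniform distributions on $[0,1]$), and $\lambda$ denotes the completion of $m$; "Lebesgue measurable" means belonging to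 the domain of $\lambda$. *)

theory Defs
  imports "HOL-Probability.Probability"
begin

(* Points of the space [0,1]^N with N = {1, 2, ...} are the functions in
   PiE {1..} (\<lambda>_. {0..1}): their value at the junk index 0 is undefined. *)

definition unit_cube :: "(nat \<Rightarrow> real) set" where
  "unit_cube = ({1..} \<rightarrow>\<^sub>E {0..1})"

definition Cyl :: "nat set \<Rightarrow> (nat \<Rightarrow> real) \<Rightarrow> (nat \<Rightarrow> real) set" where
  "Cyl K \<omega> = {\<omega>' \<in> unit_cube. \<forall>i\<in>K. \<omega>' i = \<omega> i}"

definition cyl_kernel :: "(nat \<Rightarrow> real) set \<Rightarrow> nat set \<Rightarrow> (nat \<Rightarrow> real) set" ("[_]\<^bsub>_\<^esub>") where
  "[A]\<^bsub>K\<^esub> = {\<omega> \<in> unit_cube. Cyl K \<omega> \<subseteq> A}"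

definition disj_occ :: "(nat \<Rightarrow> real) set \<Rightarrow> (nat \<Rightarrow> real) set \<Rightarrow> (nat \<Rightarrow> real) set"
    (infixl "\<box>" 70) where
  "A \<box> B = \<Union> {[A]\<^bsub>J\<^esub> \<inter> [B]\<^bsub>K\<^esub> | J K.
     J \<subseteq> {1..} \<and> K \<subseteq> {1..} \<and> finite J \<and> finite K \<and> J \<inter> K = {}}"

(* Only the values A 1, ..., A r are used. *)
definition Disj_occ :: "nat \<Rightarrow> (nat \<Rightarrow> (nat \<Rightarrow> real) set) \<Rightarrow> (nat \<Rightarrow> real) set" where
  "Disj_occ r A = \<Union> {(\<Inter>i\<in>{1..r}. [A i]\<^bsub>J i\<^esub>) | J.
     (\<forall>i\<in>{1..r}. J i \<subseteq> {1..} \<and> finite (J i)) \<and> disjoint_family_on J {1..r}}"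

definition cube_measure :: "(nat \<Rightarrow> real) measure" where
  "cube_measure = (\<Pi>\<^sub>M i\<in>{1..}. restrict_space lborel {0..1})"

lemma space_cube_measure: "space cube_measure = unit_cube"
  by (simp add: cube_measure_def space_PiM space_restrict_space unit_cube_def)

lemma prob_space_cube_measure: "prob_space cube_measure"
  unfolding cube_measure_def
  by (intro prob_space_PiM prob_spaceI)
     (simp add: space_restrict_space emeasure_restrict_space)

lemma sets_PiM_unit_interval_eq_Borel:
  fixes N :: "nat set"
  shows "sets (\<Pi>\<^sub>M i\<in>N. restrict_space lborel {0..1::real}) =
     sigma_sets (N \<rightarrow>\<^sub>E {0..1}) {U. openin (product_topology (\<lambda>i. top_of_set {0..1}) N) U}"
    (is "sets ?P = sigma_sets _ ?O")
proof -
  define Q :: "(nat \<Rightarrow> real) set" where "Q = (N \<rightarrow>\<^sub>E {0..1})"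
  have spP: "space ?P = Q"
    by (simp add: space_PiM space_restrict_space Q_def)
  have "sets ?P = sigma_sets Q ?O"
  proof
    have O: "?O \<subseteq> Pow Q"
      using openin_subset[of "product_topology (\<lambda>i. top_of_set {0..1::real}) N"]
      by (simp add: Q_def subset_eq)
    let ?N = "sigma Q ?O"
    have comp: "(\<lambda>f. f i) \<in> borel_measurable ?N" if "i \<in> N" for i
    proof (rule borel_measurableI)
      fix T :: "real set" assume "open T"
      have "continuous_map (product_topology (\<lambda>i. top_of_set {0..1::real}) N)
              (top_of_set {0..1}) (\<lambda>f. f i)"
        using that by (rule continuous_map_product_projection)
      from openin_continuous_map_preimage[OF this, of "{0..1} \<inter> T"]
      have "{f \<in> Q. f i \<in> {0..1} \<inter> T} \<in> ?O"
        using \<open>open T\<close> by (simp add: Q_def openin_open_Int)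
      moreover have "{f \<in> Q. f i \<in> {0..1} \<inter> T} = (\<lambda>f. f i) -` T \<inter> space ?N"
        using that O by (auto simp: Q_def space_measure_of_conv)
      ultimately show "(\<lambda>f. f i) -` T \<inter> space ?N \<in> sets ?N"
        using O by auto
    qed
    show "sets ?P \<subseteq> sigma_sets Q ?O"
      unfolding sets_PiM_single spP[unfolded space_PiM]
    proof (rule sigma_sets_mono, clarify)
      fix i :: nat and A :: "real set"
      assume i: "i \<in> N" and "A \<in> sets (restrict_space lborel {0..1})"
      then have "A \<in> sets borel"
        by (simp add: sets_restrict_space_iff)
      from measurable_sets[OF comp[OF i] this]
      show "{f \<in> Q. f i \<in> A} \<in> sigma_sets Q ?O"
        using O by (simp add: vimage_def Int_def conj_commute)
    qed
  next
    obtain \<B> :: "real set set" where \<B>: "countable \<B>" "topological_basis \<B>"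
      using ex_countable_basis by blast
    define C where "C J G = {f \<in> Q. \<forall>j\<in>J. f j \<in> G j}" for J :: "nat set" and G :: "nat \<Rightarrow> real set"
    define I where "I = (SIGMA J:{J. finite J \<and> J \<subseteq> N}. J \<rightarrow>\<^sub>E \<B>)"
    have "countable {J :: nat set. finite J \<and> J \<subseteq> N}"
      by (rule countable_subset[OF _ countable_Collect_finite]) auto
    then have I: "countable I"
      unfolding I_def using \<B> by (intro countable_SIGMA countable_PiE) auto
    have C: "C J G \<in> sets ?P" if "(J, G) \<in> I" for J G
    proof -
      have G: "G j \<in> sets borel" if "j \<in> J" for j
      proof -
        have "G j \<in> \<B>" using \<open>(J, G) \<in> I\<close> that by (auto simp: I_def)
        then show ?thesis using \<B>(2) by (intro borel_open topological_basis_open)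
      qed
      have "finite J" "J \<subseteq> N" using \<open>(J, G) \<in> I\<close> by (auto simp: I_def)
      have "{f \<in> space ?P. f j \<in> G j} \<in> sets ?P" if "j \<in> J" for j
      proof -
        have "(\<lambda>f. f j) \<in> measurable ?P (restrict_space lborel {0..1})"
          using that \<open>J \<subseteq> N\<close> by (intro measurable_component_singleton) auto
        then have "(\<lambda>f. f j) \<in> borel_measurable ?P"
          by (simp add: measurable_restrict_space2_iff)
        from measurable_sets[OF this G[OF that]] show ?thesis
          by (simp add: vimage_def Int_def conj_commute)
      qed
      then have "{f \<in> space ?P. \<forall>j\<in>J. f j \<in> G j} \<in> sets ?P"
        using \<open>finite J\<close> by (intro sets.sets_Collect_finite_All) auto
      then show ?thesis by (simp add: C_def spP)
    qed
    show "sigma_sets Q ?O \<subseteq> sets ?P"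
      unfolding spP[symmetric]
    proof (rule sets.sigma_sets_subset, clarify)
      fix U assume U: "openin (product_topology (\<lambda>i. top_of_set {0..1::real}) N) U"
      from openin_subset[OF this] have Usub: "U \<subseteq> Q"
        by (simp add: Q_def)
      have "U = (\<Union>(J, G)\<in>{(J, G) \<in> I. C J G \<subseteq> U}. C J G)"
      proof (intro equalityI subsetI)
        fix x assume "x \<in> U"
        with U have "\<exists>V. finite {i \<in> N. V i \<noteq> topspace (top_of_set {0..1::real})} \<and>
            (\<forall>i\<in>N. openin (top_of_set {0..1}) (V i)) \<and> x \<in> Pi\<^sub>E N V \<and> Pi\<^sub>E N V \<subseteq> U"
          unfolding openin_product_topology_alt by blast
        then obtain V where V: "finite {i \<in> N. V i \<noteq> {0..1}}"
            "\<And>i. i \<in> N \<Longrightarrow> openin (top_of_set {0..1}) (V i)"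
            "x \<in> Pi\<^sub>E N V" "Pi\<^sub>E N V \<subseteq> U"
          unfolding topspace_euclidean_subtopology by blast
        define J where "J = {i \<in> N. V i \<noteq> {0..1}}"
        have "\<exists>B\<in>\<B>. x i \<in> B \<and> {0..1} \<inter> B \<subseteq> V i" if i: "i \<in> J" for i
        proof -
          from V(2)[of i] i obtain T where T: "open T" "V i = {0..1} \<inter> T"
            by (auto simp: J_def openin_open)
          have "i \<in> N" using i by (simp add: J_def)
          with V(3) have "x i \<in> V i" by (rule PiE_mem)
          then have "x i \<in> T" using T(2) by simp
          with topological_basisE[OF \<B>(2) T(1)] obtain B where "B \<in> \<B>" "x i \<in> B" "B \<subseteq> T"
            by metis
          then show ?thesis using T(2) by blast
        qed
        then obtain G where G: "\<And>i. i \<in> J \<Longrightarrow> G i \<in> \<B> \<and> x i \<in> G i \<and> {0..1} \<inter> G i \<subseteq> V i"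
          by metis
        have "C J (restrict G J) \<subseteq> Pi\<^sub>E N V"
        proof
          fix f assume f: "f \<in> C J (restrict G J)"
          have "f i \<in> V i" if "i \<in> N" for i
          proof (cases "i \<in> J")
            case True
            then show ?thesis using f G[OF True] that by (auto simp: C_def Q_def PiE_iff)
          next
            case False
            then have "V i = {0..1}" using that by (simp add: J_def)
            then show ?thesis using f that by (auto simp: C_def Q_def PiE_iff)
          qed
          then show "f \<in> Pi\<^sub>E N V" using f by (auto simp: C_def Q_def PiE_iff)
        qed
        moreover have "(J, restrict G J) \<in> I"
        proof -
          have "finite J" "J \<subseteq> N" using V(1) by (auto simp: J_def)
          moreover have "restrict G J \<in> J \<rightarrow>\<^sub>E \<B>" using G by (intro restrict_PiE_iff[THEN iffD2] ballI) blast
          ultimately show ?thesis unfolding I_def by blast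
        qed
        moreover have "x \<in> C J (restrict G J)"
        proof -
          have "x \<in> Q" using \<open>x \<in> U\<close> Usub by blast
          moreover have "\<forall>j\<in>J. x j \<in> restrict G J j" using G by simp
          ultimately show ?thesis unfolding C_def by blast
        qed
        ultimately show "x \<in> (\<Union>(J, G)\<in>{(J, G) \<in> I. C J G \<subseteq> U}. C J G)"
          using V(4) by (intro UN_I[of "(J, restrict G J)"]) (simp_all only: mem_Collect_eq case_prod_conv, blast)
      next
        fix x assume "x \<in> (\<Union>(J, G)\<in>{(J, G) \<in> I. C J G \<subseteq> U}. C J G)"
        then show "x \<in> U" by blast
      qed
      also have "\<dots> \<in> sets ?P"
      proof (rule sets.countable_UN')
        show "countable {(J, G) \<in> I. C J G \<subseteq> U}"
          by (rule countable_subset[OF _ I]) blast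
        show "(\<lambda>(J, G). C J G) ` {(J, G) \<in> I. C J G \<subseteq> U} \<subseteq> sets ?P"
          using C by (intro image_subsetI) (simp add: split_beta)
      qed
      finally show "U \<in> sets ?P" .
    qed
  qed
  then show ?thesis by (simp add: Q_def)
qed

(* The domain of cube_measure is the Borel sigma-algebra of the product topology on [0,1]^N. *)
lemma sets_cube_measure_eq_Borel:
  "sets cube_measure =
     sigma_sets unit_cube {U. openin (product_topology (\<lambda>i. top_of_set {0..1}) {1..}) U}"
  unfolding cube_measure_def unit_cube_def by (rule sets_PiM_unit_interval_eq_Borel)

end

theory Submission
  imports Defs
begin

text \<open>
  The sets \<open>A \<box> B\<close> and \<open>Disj_occ r A\<close> are countable unions of finite intersections of cylinder kernels,
  and the complement of \<open>[A]\<^bsub>K\<^esub>\<close> is the projection of a Borel set, hence a Suslin set; Suslin sets are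
  measurable by Choquet's capacitability argument.

  For the inequality it suffices to allow only reasons inside \<open>{1..n}\<close> and let \<open>n\<close> tend to infinity.
  Conditionally on the unordered pairs \<open>{x i, y i}\<close>, \<open>i \<le> n\<close>, two independent points \<open>x, y\<close> form a
  uniformly distributed antipodal pair of a discrete cube, so the product inequality follows from
  Reimer's theorem that \<open>A \<box> B\<close> has at most as many points as the intersection of \<open>A\<close> with the antipode
  of \<open>B\<close>. Reimer's theorem is a rank argument with tensor products. The case of \<open>r\<close> sets follows by
  induction, since all sets involved depend on the first \<open>n\<close> coordinates only.
\<close>

section \<open>Reimer's theorem on the discrete cube\<close>

text \<open>Gaussian elimination by cross-multiplication: no division occurs, so solutions exist in
  any integral domain. Integer coefficients are wanted because the independence proof for the
  tensors works modulo 2.\<close>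

lemma homogeneous_system_nontrivial_solution:
  fixes c :: "'e \<Rightarrow> 's \<Rightarrow> 'a :: idom"
  assumes "finite E" "finite S" "card E < card S"
  shows "\<exists>a. (\<exists>s\<in>S. a s \<noteq> 0) \<and> (\<forall>e\<in>E. (\<Sum>s\<in>S. a s * c e s) = 0)"
  using assms
proof (induction E arbitrary: S c rule: finite_induct)
  case empty
  then have "S \<noteq> {}" by auto
  then show ?case by (intro exI[of _ "\<lambda>_. 1"]) auto
next
  case (insert e E)
  show ?case
  proof (cases "\<forall>s\<in>S. c e s = 0")
    case True
    have "card E < card S" using insert by simp
    from insert.IH[OF insert.prems(1) this, of c] show ?thesis using True by auto
  next
    case False
    then obtain s where s: "s \<in> S" "c e s \<noteq> 0" by blast
    define T where "T = S - {s}"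
    have T: "finite T" "s \<notin> T" "S = insert s T" using s insert.prems by (auto simp: T_def)
    have "card E < card T" using insert.prems insert.hyps T by simp
    from insert.IH[OF T(1) this, of "\<lambda>f t. c e s * c f t - c e t * c f s"]
    obtain a where a: "\<exists>t\<in>T. a t \<noteq> 0"
      "\<And>f. f \<in> E \<Longrightarrow> (\<Sum>t\<in>T. a t * (c e s * c f t - c e t * c f s)) = 0" by blast
    \<comment> \<open>Scaling the reduced solution by the pivot \<open>c e s\<close> lets the value
      at \<open>s\<close> cancel equation \<open>e\<close> exactly, without division.\<close>
    define b where "b t = (if t = s then - (\<Sum>t\<in>T. a t * c e t) else c e s * a t)" for t
    have sum_b: "(\<Sum>t\<in>S. b t * g t) = c e s * (\<Sum>t\<in>T. a t * g t) - (\<Sum>t\<in>T. a t * c e t) * g s" for g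
    proof -
      have "(\<Sum>t\<in>T. b t * g t) = (\<Sum>t\<in>T. c e s * (a t * g t))"
        using T by (intro sum.cong) (auto simp: b_def algebra_simps)
      then show ?thesis using T by (simp add: b_def sum_distrib_left)
    qed
    have "(\<Sum>t\<in>S. b t * c f t) = 0" if "f \<in> insert e E" for f
    proof (cases "f = e")
      case True
      then show ?thesis unfolding sum_b by simp
    next
      case False
      then have "(\<Sum>t\<in>T. a t * (c e s * c f t - c e t * c f s)) = 0" using a(2) that by simp
      then show ?thesis unfolding sum_b
        by (simp add: algebra_simps sum_subtractf sum_distrib_left sum_distrib_right)
    qed
    moreover have "\<exists>t\<in>S. b t \<noteq> 0"
      using a(1) s T by (auto simp: b_def)
    ultimately show ?thesis by blast
  qed
qed

lemma sum_Pow_insert: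
  fixes f :: "'a set \<Rightarrow> 'b :: comm_monoid_add"
  assumes "finite I" "i \<notin> I"
  shows "sum f (Pow (insert i I)) = (\<Sum>x\<in>Pow I. f x) + (\<Sum>x\<in>Pow I. f (insert i x))"
proof -
  have "sum f (insert i ` Pow I) = (\<Sum>x\<in>Pow I. f (insert i x))"
    using assms by (subst sum.reindex) (auto simp: inj_on_def)
  moreover have "Pow I \<inter> insert i ` Pow I = {}" using assms by auto
  ultimately show ?thesis
    using assms by (simp add: Pow_insert sum.union_disjoint)
qed

text \<open>Distributivity, with a subset \<open>z\<close> recording which summand is taken in each
  factor. Inner products of tensors thereby become products over the coordinates.\<close>

lemma sum_Pow_prod:
  fixes f :: "'a \<Rightarrow> bool \<Rightarrow> 'b :: comm_semiring_1"
  assumes "finite I"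
  shows "(\<Sum>z\<in>Pow I. \<Prod>i\<in>I. f i (i \<in> z)) = (\<Prod>i\<in>I. f i False + f i True)"
  using assms
proof (induction I rule: finite_induct)
  case (insert j I)
  have 1: "(\<Prod>i\<in>insert j I. f i (i \<in> z)) = f j False * (\<Prod>i\<in>I. f i (i \<in> z))" if "z \<in> Pow I" for z
  proof -
    have "j \<notin> z" using that insert.hyps by auto
    then show ?thesis using insert.hyps by simp
  qed
  have 2: "(\<Prod>i\<in>insert j I. f i (i \<in> insert j z)) = f j True * (\<Prod>i\<in>I. f i (i \<in> z))" if "z \<in> Pow I" for z
  proof -
    have "(\<Prod>i\<in>I. f i (i \<in> insert j z)) = (\<Prod>i\<in>I. f i (i \<in> z))"
    proof (rule prod.cong[OF refl])
      fix i assume "i \<in> I"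
      then have "i \<noteq> j" using insert.hyps by blast
      then show "f i (i \<in> insert j z) = f i (i \<in> z)" by simp
    qed
    then show ?thesis using insert.hyps by simp
  qed
  have "(\<Sum>z\<in>Pow (insert j I). \<Prod>i\<in>insert j I. f i (i \<in> z)) =
      (\<Sum>z\<in>Pow I. f j False * (\<Prod>i\<in>I. f i (i \<in> z))) + (\<Sum>z\<in>Pow I. f j True * (\<Prod>i\<in>I. f i (i \<in> z)))"
    unfolding sum_Pow_insert[OF insert.hyps]
    by (rule arg_cong2[where f = "(+)"]; rule sum.cong[OF refl]; rule 1 2; assumption)
  then show ?case
    using insert.hyps by (simp add: insert.IH distrib_right flip: sum_distrib_left)
qed simp

text \<open>
  The vectors of Reimer's tensor argument, indexed by a coordinate value \<open>b\<close> of a point and by whether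
  the coordinate belongs to the chosen set of reasons (\<open>j\<close>); the last argument selects the component.
  They satisfy \<open>p = T v\<close> and \<open>q = (T\<^sup>-\<^sup>1)\<^sup>t v\<close> for \<open>T\<close> with rows \<open>(1, -1)\<close> and \<open>(0, 1)\<close>, so \<open>p\<close> and \<open>q\<close> have the
  Gram matrix of \<open>v\<close>. Moreover \<open>p\<close> is concentrated on \<open>b\<close> if \<open>j\<close>, and \<open>q\<close> on \<open>\<not> b\<close> if \<open>\<not> j\<close>.
\<close>

definition reimer_v :: "bool \<Rightarrow> bool \<Rightarrow> bool \<Rightarrow> int" where
  "reimer_v b j z = (if b then (if j \<or> \<not> z then 1 else -1) else if z = j then 0 else 1)"

definition reimer_p :: "bool \<Rightarrow> bool \<Rightarrow> bool \<Rightarrow> int" where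
  "reimer_p b j z = (if j then of_bool (z = b) else if b then (if z then -1 else 2) else (if z then 1 else -1))"

definition reimer_q :: "bool \<Rightarrow> bool \<Rightarrow> bool \<Rightarrow> int" where
  "reimer_q b j z = (if \<not> j then of_bool (z \<noteq> b) else if b \<and> z then 2 else 1)"

lemma reimer_dual:
  "reimer_p b j False * reimer_q b' j' False + reimer_p b j True * reimer_q b' j' True =
   reimer_v b j False * reimer_v b' j' False + reimer_v b j True * reimer_v b' j' True"
  by (cases b; cases j; cases b'; cases j') (simp_all add: reimer_v_def reimer_p_def reimer_q_def)

text \<open>The tensor product over \<open>I\<close> of the two-component vectors selected by
  \<open>x\<close> and \<open>J\<close>. Its components are indexed by subsets \<open>z\<close> of
  \<open>I\<close>, just like the points of the discrete cube.\<close>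

definition reimer_tensor :: "(bool \<Rightarrow> bool \<Rightarrow> bool \<Rightarrow> int) \<Rightarrow> 'i set \<Rightarrow> 'i set \<Rightarrow> 'i set \<Rightarrow> 'i set \<Rightarrow> int" where
  "reimer_tensor u I x J z = (\<Prod>i\<in>I. u (i \<in> x) (i \<in> J) (i \<in> z))"

text \<open>Both sides factor over the coordinates, where the Gram matrices agree by
  \<open>reimer_dual\<close>.\<close>

lemma reimer_tensor_dual:
  assumes "finite I"
  shows "(\<Sum>z\<in>Pow I. reimer_tensor reimer_p I x J z * reimer_tensor reimer_q I y K z) =
         (\<Sum>z\<in>Pow I. reimer_tensor reimer_v I x J z * reimer_tensor reimer_v I y K z)"
  unfolding reimer_tensor_def prod.distrib[symmetric]
  using sum_Pow_prod[OF assms, of "\<lambda>i c. reimer_p (i \<in> x) (i \<in> J) c * reimer_q (i \<in> y) (i \<in> K) c"]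
    sum_Pow_prod[OF assms, of "\<lambda>i c. reimer_v (i \<in> x) (i \<in> J) c * reimer_v (i \<in> y) (i \<in> K) c"]
  by (simp add: reimer_dual)

text \<open>
  Modulo 2 both vectors with \<open>b\<close> true equal \<open>(1, 1)\<close>, whose components sum to 0, while those with \<open>b\<close>
  false have component sum 1; hence adding up the two halves isolates the coefficients of the points
  avoiding the new coordinate.
\<close>

lemma reimer_v_independent_mod_2:
  assumes "finite I"
    and "\<And>z. z \<subseteq> I \<Longrightarrow> even (\<Sum>x\<in>Pow I. a x * reimer_tensor reimer_v I x (J x) z)"
    and "x \<subseteq> I"
  shows "even (a x)"
  using assms
proof (induction I arbitrary: a J x rule: finite_induct)
  case empty
  then show ?case by (simp add: reimer_tensor_def)
next
  case (insert j I)
  \<comment> \<open>The two halves of the cube carry different choices of reasons, \<open>J\<close>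
    and \<open>\<lambda>x. J (insert j x)\<close>; the induction is therefore over arbitrary
    \<open>J\<close>.\<close>
  define w where "w x z = reimer_tensor reimer_v I x (J x) z" for x z
  define w' where "w' x z = reimer_tensor reimer_v I x (J (insert j x)) z" for x z
  have split: "reimer_tensor reimer_v (insert j I) x K z =
      reimer_v (j \<in> x) (j \<in> K) (j \<in> z) * reimer_tensor reimer_v I x K z" for x K z
    using insert.hyps by (simp add: reimer_tensor_def)
  have cong: "reimer_tensor reimer_v I (insert j x) K z = reimer_tensor reimer_v I x K z"
    "reimer_tensor reimer_v I x K (insert j z) = reimer_tensor reimer_v I x K z" for x K z
  proof -
    have ne: "i \<in> insert j y \<longleftrightarrow> i \<in> y" if "i \<in> I" for i y using insert.hyps that by blast
    show "reimer_tensor reimer_v I (insert j x) K z = reimer_tensor reimer_v I x K z"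
      "reimer_tensor reimer_v I x K (insert j z) = reimer_tensor reimer_v I x K z"
      unfolding reimer_tensor_def by (intro prod.cong refl; simp only: ne)+
  qed
  have sum: "(\<Sum>x\<in>Pow (insert j I). a x * reimer_tensor reimer_v (insert j I) x (J x) z) =
     (\<Sum>x\<in>Pow I. a x * (reimer_v False (j \<in> J x) (j \<in> z) * w x z)) +
     (\<Sum>x\<in>Pow I. a (insert j x) * (reimer_v True (j \<in> J (insert j x)) (j \<in> z) * w' x z))" for z
  proof -
    have "j \<notin> x" if "x \<in> Pow I" for x using that insert.hyps by auto
    then show ?thesis
      using insert.hyps by (simp add: sum_Pow_insert split cong w_def w'_def)
  qed
  have E0: "even ((\<Sum>x\<in>Pow I. a x * (reimer_v False (j \<in> J x) False * w x z)) +
     (\<Sum>x\<in>Pow I. a (insert j x) * w' x z))" if "z \<subseteq> I" for z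
  proof -
    have "j \<notin> z" using that insert.hyps by auto
    moreover have "even (\<Sum>x\<in>Pow (insert j I). a x * reimer_tensor reimer_v (insert j I) x (J x) z)"
      using that by (intro insert.prems) auto
    ultimately show ?thesis by (simp add: sum reimer_v_def)
  qed
  have E1: "even ((\<Sum>x\<in>Pow I. a x * (reimer_v False (j \<in> J x) True * w x z)) +
     (\<Sum>x\<in>Pow I. a (insert j x) * (reimer_v True (j \<in> J (insert j x)) True * w' x z)))" if "z \<subseteq> I" for z
  proof -
    have "even (\<Sum>x\<in>Pow (insert j I). a x * reimer_tensor reimer_v (insert j I) x (J x) (insert j z))"
      using that by (intro insert.prems) auto
    moreover have "w x (insert j z) = w x z" "w' x (insert j z) = w' x z" for x
      by (simp_all add: w_def w'_def cong)
    ultimately show ?thesis by (simp add: sum)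
  qed
  have even_a: "even (a x)" if "x \<subseteq> I" for x
  proof (rule insert.IH[of a J x])
    fix z assume z: "z \<subseteq> I"
    \<comment> \<open>The components of \<open>reimer_v\<close> sum to 1 for \<open>b\<close> false,
      and to 2 or 0 for \<open>b\<close> true, according to \<open>j\<close>.\<close>
    have "(\<Sum>x\<in>Pow I. a x * w x z) + 2 * (\<Sum>x\<in>Pow I. a (insert j x) * (of_bool (j \<in> J (insert j x)) * w' x z)) =
      ((\<Sum>x\<in>Pow I. a x * (reimer_v False (j \<in> J x) False * w x z)) +
     (\<Sum>x\<in>Pow I. a (insert j x) * w' x z)) +
     ((\<Sum>x\<in>Pow I. a x * (reimer_v False (j \<in> J x) True * w x z)) +
     (\<Sum>x\<in>Pow I. a (insert j x) * (reimer_v True (j \<in> J (insert j x)) True * w' x z)))"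
      unfolding sum_distrib_left sum.distrib[symmetric]
      by (intro sum.cong) (auto simp: reimer_v_def)
    also have "even \<dots>" using E0[OF z] E1[OF z] by simp
    finally show "even (\<Sum>x\<in>Pow I. a x * reimer_tensor reimer_v I x (J x) z)"
      by (simp add: w_def)
  qed (use that in auto)
  \<comment> \<open>Once the coefficients of the points avoiding \<open>j\<close> are even, the
    equation at components avoiding \<open>j\<close> is one about the other half alone.\<close>
  have even_a': "even (a (insert j x))" if "x \<subseteq> I" for x
  proof (rule insert.IH[of "\<lambda>x. a (insert j x)" "\<lambda>x. J (insert j x)" x])
    fix z assume z: "z \<subseteq> I"
    have "even (\<Sum>x\<in>Pow I. a x * (reimer_v False (j \<in> J x) False * w x z))"
      using even_a by (intro dvd_sum) auto
    with E0[OF z] show "even (\<Sum>x\<in>Pow I. a (insert j x) * reimer_tensor reimer_v I x (J (insert j x)) z)"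
      by (simp add: w'_def)
  qed (use that in auto)
  show ?case
  proof (cases "j \<in> x")
    case True
    then have "x = insert j (x - {j})" "x - {j} \<subseteq> I" using insert.prems by auto
    then show ?thesis using even_a' by metis
  next
    case False
    then show ?thesis using even_a insert.prems by auto
  qed
qed

text \<open>Descent: a vanishing integer combination can be halved for ever.\<close>

lemma reimer_v_independent:
  assumes "finite I"
    and "\<And>z. z \<subseteq> I \<Longrightarrow> (\<Sum>x\<in>Pow I. a x * reimer_tensor reimer_v I x (J x) z) = 0"
    and "x \<subseteq> I"
  shows "a x = 0"
proof -
  have "\<exists>b. (\<forall>x\<subseteq>I. a x = 2 ^ k * b x) \<and>
      (\<forall>z\<subseteq>I. (\<Sum>x\<in>Pow I. b x * reimer_tensor reimer_v I x (J x) z) = 0)" for k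
  proof (induction k)
    case 0
    then show ?case using assms by (intro exI[of _ a]) simp
  next
    case (Suc k)
    then obtain b where b: "\<And>x. x \<subseteq> I \<Longrightarrow> a x = 2 ^ k * b x"
      "\<And>z. z \<subseteq> I \<Longrightarrow> (\<Sum>x\<in>Pow I. b x * reimer_tensor reimer_v I x (J x) z) = 0" by blast
    have ev: "even (b x)" if "x \<subseteq> I" for x
      using reimer_v_independent_mod_2[OF assms(1) _ that, of b J] b(2) by simp
    have half: "2 * (\<Sum>x\<in>Pow I. (b x div 2) * reimer_tensor reimer_v I x (J x) z) =
        (\<Sum>x\<in>Pow I. b x * reimer_tensor reimer_v I x (J x) z)" for z
      unfolding sum_distrib_left using ev by (intro sum.cong) auto
    have "(\<Sum>x\<in>Pow I. (b x div 2) * reimer_tensor reimer_v I x (J x) z) = 0" if "z \<subseteq> I" for z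
      using half[of z] b(2)[OF that] by linarith
    moreover have "a x = 2 ^ Suc k * (b x div 2)" if "x \<subseteq> I" for x
      using b(1)[OF that] ev[OF that] by auto
    ultimately show ?case by (intro exI[of _ "\<lambda>x. b x div 2"]) blast
  qed
  then have "2 ^ k dvd a x" for k using assms(3) by (metis dvd_triv_left)
  \<comment> \<open>The exponent is chosen so that the power of 2 exceeds the absolute value of
    \<open>a x\<close>, which forces \<open>a x\<close> to be 0.\<close>
  then have dvd: "2 ^ nat \<bar>a x\<bar> dvd a x" .
  show ?thesis
  proof (rule ccontr)
    assume "a x \<noteq> 0"
    from dvd_imp_le_int[OF this dvd] have "2 ^ nat \<bar>a x\<bar> \<le> \<bar>a x\<bar>" by simp
    moreover have "\<bar>a x\<bar> < 2 ^ nat \<bar>a x\<bar>"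
    proof -
      have "int (nat \<bar>a x\<bar>) < int (2 ^ nat \<bar>a x\<bar>)"
        unfolding of_nat_less_iff by (rule less_exp)
      then show ?thesis by simp
    qed
    ultimately show False by simp
  qed
qed

text \<open>At a coordinate in \<open>J\<close> the factor of the tensor is an indicator of
  agreement with \<open>x\<close>.\<close>

lemma reimer_p_support:
  assumes "finite I" "reimer_tensor reimer_p I x J z \<noteq> 0"
  shows "z \<inter> (I \<inter> J) = x \<inter> (I \<inter> J)"
proof -
  have "reimer_p (i \<in> x) (i \<in> J) (i \<in> z) \<noteq> 0" if "i \<in> I" for i
    using assms that by (auto simp: reimer_tensor_def)
  then have "(i \<in> z) = (i \<in> x)" if "i \<in> I" "i \<in> J" for i
    using that by (force simp: reimer_p_def)
  then show ?thesis by blast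
qed

text \<open>At a coordinate outside \<open>J\<close> the factor is an indicator of disagreement with
  \<open>x\<close>, hence the complement of \<open>z\<close> on the left.\<close>

lemma reimer_q_support:
  assumes "finite I" "reimer_tensor reimer_q I x J z \<noteq> 0"
  shows "(I - z) \<inter> (I - J) = x \<inter> (I - J)"
proof -
  have "reimer_q (i \<in> x) (i \<in> J) (i \<in> z) \<noteq> 0" if "i \<in> I" for i
    using assms that by (auto simp: reimer_tensor_def)
  then have "(i \<in> z) \<noteq> (i \<in> x)" if "i \<in> I" "i \<notin> J" for i
    using that by (force simp: reimer_q_def)
  then show ?thesis by blast
qed

text \<open>
  With too few points in the target, some combination of the \<open>p\<close>-tensors vanishes there; its inner
  product with the same combination of the \<open>q\<close>-tensors is then 0, although it equals the squared norm
  of the combination of the \<open>v\<close>-tensors.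
\<close>

lemma reimer_butterfly:
  assumes "finite I" "S \<subseteq> Pow I"
    and A: "\<And>x z. x \<in> S \<Longrightarrow> z \<subseteq> I \<Longrightarrow> z \<inter> (I \<inter> J x) = x \<inter> (I \<inter> J x) \<Longrightarrow> z \<in> A"
    and B: "\<And>x z. x \<in> S \<Longrightarrow> z \<subseteq> I \<Longrightarrow> z \<inter> (I - J x) = x \<inter> (I - J x) \<Longrightarrow> z \<in> B"
  shows "card S \<le> card {z \<in> Pow I. z \<in> A \<and> I - z \<in> B}"
proof (rule ccontr)
  let ?E = "{z \<in> Pow I. z \<in> A \<and> I - z \<in> B}"
  define p where "p x z = reimer_tensor reimer_p I x (J x) z" for x z
  define q where "q x z = reimer_tensor reimer_q I x (J x) z" for x z
  define v where "v x z = reimer_tensor reimer_v I x (J x) z" for x z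
  have fin: "finite ?E" "finite S" using assms(1,2) by (auto intro: finite_subset)
  assume "\<not> card S \<le> card ?E"
  then obtain a :: "'a set \<Rightarrow> int" where a: "\<exists>x\<in>S. a x \<noteq> 0"
    "\<And>z. z \<in> ?E \<Longrightarrow> (\<Sum>x\<in>S. a x * p x z) = 0"
    using homogeneous_system_nontrivial_solution[OF fin, of "\<lambda>z x. p x z"] by auto
  have swap: "(\<Sum>z\<in>Pow I. \<Sum>x\<in>S. \<Sum>y\<in>S. a x * a y * g x y z) =
      (\<Sum>x\<in>S. \<Sum>y\<in>S. a x * a y * (\<Sum>z\<in>Pow I. g x y z))" for g
  proof -
    have "(\<Sum>z\<in>Pow I. \<Sum>x\<in>S. \<Sum>y\<in>S. a x * a y * g x y z) =
        (\<Sum>x\<in>S. \<Sum>z\<in>Pow I. \<Sum>y\<in>S. a x * a y * g x y z)"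
      by (rule sum.swap)
    also have "\<dots> = (\<Sum>x\<in>S. \<Sum>y\<in>S. \<Sum>z\<in>Pow I. a x * a y * g x y z)"
      by (intro sum.cong[OF refl] sum.swap)
    finally show ?thesis by (simp add: sum_distrib_left)
  qed
  have "(\<Sum>z\<in>Pow I. (\<Sum>x\<in>S. a x * v x z) ^ 2) = (\<Sum>z\<in>Pow I. \<Sum>x\<in>S. \<Sum>y\<in>S. a x * a y * (v x z * v y z))"
    by (simp add: power2_eq_square sum_product mult_ac)
  also have "\<dots> = (\<Sum>x\<in>S. \<Sum>y\<in>S. a x * a y * (\<Sum>z\<in>Pow I. v x z * v y z))"
    by (rule swap)
  also have "\<dots> = (\<Sum>x\<in>S. \<Sum>y\<in>S. a x * a y * (\<Sum>z\<in>Pow I. p x z * q y z))"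
    by (simp add: p_def q_def v_def reimer_tensor_dual assms(1))
  also have "\<dots> = (\<Sum>z\<in>Pow I. \<Sum>x\<in>S. \<Sum>y\<in>S. a x * a y * (p x z * q y z))"
    by (rule swap[symmetric])
  also have "\<dots> = (\<Sum>z\<in>Pow I. (\<Sum>x\<in>S. a x * p x z) * (\<Sum>y\<in>S. a y * q y z))"
    by (simp add: sum_product mult_ac)
  also have "\<dots> = 0"
  proof (rule sum.neutral, safe)
    fix z assume z: "z \<subseteq> I"
    \<comment> \<open>A nonzero \<open>p\<close>-component at \<open>z\<close> makes
      \<open>z\<close> agree with \<open>x\<close> on the reasons for \<open>A\<close>, so
      \<open>z\<close> lies in \<open>A\<close>; a nonzero \<open>q\<close>-component likewise puts
      the complement of \<open>z\<close> into \<open>B\<close>. So one factor vanishes off the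
      target set, and on it the first vanishes by the choice of \<open>a\<close>.\<close>
    have 1: "z \<in> A" if "x \<in> S" "p x z \<noteq> 0" for x
      using A[OF that(1) z] reimer_p_support[OF assms(1)] that(2) unfolding p_def by blast
    have 2: "I - z \<in> B" if "x \<in> S" "q x z \<noteq> 0" for x
      using B[OF that(1), of "I - z"] reimer_q_support[OF assms(1)] that(2) unfolding q_def by blast
    show "(\<Sum>x\<in>S. a x * p x z) * (\<Sum>y\<in>S. a y * q y z) = 0"
    proof (cases "z \<in> A \<and> I - z \<in> B")
      case True
      then show ?thesis using a(2) z by simp
    next
      case False
      then have "(\<forall>x\<in>S. p x z = 0) \<or> (\<forall>x\<in>S. q x z = 0)" using 1 2 by blast
      then show ?thesis by auto
    qed
  qed
  finally have sq: "\<forall>z\<in>Pow I. (\<Sum>x\<in>S. a x * v x z) ^ 2 = 0"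
    using assms(1) by (subst (asm) sum_nonneg_eq_0_iff) auto
  \<comment> \<open>The combination is extended by 0 to all points, since independence is stated for
    one tensor per point of the whole cube.\<close>
  have "(\<Sum>x\<in>Pow I. (if x \<in> S then a x else 0) * v x z) = 0" if "z \<subseteq> I" for z
  proof -
    have "(\<Sum>x\<in>Pow I. (if x \<in> S then a x else 0) * v x z) = (\<Sum>x\<in>S. a x * v x z)"
      using assms(1,2) by (intro sum.mono_neutral_cong_right) auto
    then show ?thesis using sq that by simp
  qed
  then have "(if x \<in> S then a x else 0) = 0" if "x \<in> S" for x
    using reimer_v_independent[OF assms(1), of "\<lambda>x. if x \<in> S then a x else 0" J x] assms(2) that
    unfolding v_def by blast
  then show False using a(1) by auto
qed

section \<open>Averaging over coordinate swaps\<close>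

definition mix :: "'i set \<Rightarrow> 'i set \<Rightarrow> ('i \<Rightarrow> 'a) \<Rightarrow> ('i \<Rightarrow> 'a) \<Rightarrow> 'i \<Rightarrow> 'a" where
  "mix I e x y = (\<lambda>i\<in>I. if i \<in> e then y i else x i)"

lemma measurable_mix [measurable]:
  "(\<lambda>(x, y). mix I e x y) \<in> PiM I M \<Otimes>\<^sub>M PiM I M \<rightarrow>\<^sub>M PiM I M"
  "(\<lambda>(x, y). mix I e y x) \<in> PiM I M \<Otimes>\<^sub>M PiM I M \<rightarrow>\<^sub>M PiM I M"
proof -
  have "(\<lambda>z. if i \<in> e then snd z i else fst z i) \<in> PiM I M \<Otimes>\<^sub>M PiM I M \<rightarrow>\<^sub>M M i"
    "(\<lambda>z. if i \<in> e then fst z i else snd z i) \<in> PiM I M \<Otimes>\<^sub>M PiM I M \<rightarrow>\<^sub>M M i"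
    if [measurable]: "i \<in> I" for i
    by measurable
  then show "(\<lambda>(x, y). mix I e x y) \<in> PiM I M \<Otimes>\<^sub>M PiM I M \<rightarrow>\<^sub>M PiM I M"
    "(\<lambda>(x, y). mix I e y x) \<in> PiM I M \<Otimes>\<^sub>M PiM I M \<rightarrow>\<^sub>M PiM I M"
    unfolding mix_def split_beta by (intro measurable_restrict; simp)+
qed

text \<open>At each index the two points have independent coordinates with the same law, and these
  are exchanged for indices in \<open>e\<close>. As \<open>I\<close> may be infinite, the laws are
  compared on finite-dimensional cylinders.\<close>

lemma distr_mix_pair_PiM:
  assumes M: "\<And>i. i \<in> I \<Longrightarrow> prob_space (M i)"
  shows "distr (PiM I M \<Otimes>\<^sub>M PiM I M) (PiM I M \<Otimes>\<^sub>M PiM I M) (\<lambda>(x, y). (mix I e x y, mix I e y x)) =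
     PiM I M \<Otimes>\<^sub>M PiM I M"
proof -
  let ?P = "PiM I M" and ?K = "I \<times> (UNIV :: bool set)"
  define N where "N = (\<lambda>k :: 'a \<times> bool. M (fst k))"
  let ?W = "PiM ?K N"
  \<comment> \<open>Through \<open>\<Phi> e\<close> a pair becomes a family indexed by \<open>I \<times> bool\<close>; its law does not depend on \<open>e\<close>.\<close>
  define \<Phi> where "\<Phi> e = (\<lambda>(x, y). \<lambda>k\<in>?K. if snd k = (fst k \<in> e) then x (fst k) else y (fst k) :: 'b)" for e
  define g where "g \<omega> = (\<lambda>i\<in>I. \<omega> (i, False) :: 'b, \<lambda>i\<in>I. \<omega> (i, True))" for \<omega>
  interpret P: prob_space ?P using M by (rule prob_space_PiM)
  interpret W: prob_space ?W using M by (intro prob_space_PiM) (auto simp: N_def)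
  interpret PP: pair_prob_space ?P ?P ..
  have \<Phi>[measurable]: "\<Phi> e \<in> ?P \<Otimes>\<^sub>M ?P \<rightarrow>\<^sub>M ?W" for e
    unfolding \<Phi>_def split_beta
  proof (rule measurable_restrict)
    fix k assume "k \<in> ?K"
    then have [measurable]: "fst k \<in> I" by auto
    show "(\<lambda>x. if snd k = (fst k \<in> e) then fst x (fst k) else snd x (fst k)) \<in> ?P \<Otimes>\<^sub>M ?P \<rightarrow>\<^sub>M N k"
      unfolding N_def by measurable
  qed
  have g[measurable]: "g \<in> ?W \<rightarrow>\<^sub>M ?P \<Otimes>\<^sub>M ?P"
  proof -
    have "(\<lambda>\<omega>. \<lambda>i\<in>I. \<omega> (i, b)) \<in> ?W \<rightarrow>\<^sub>M ?P" for b
    proof (rule measurable_restrict)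
      fix i assume "i \<in> I"
      then have "(\<lambda>\<omega>. \<omega> (i, b)) \<in> ?W \<rightarrow>\<^sub>M N (i, b)" by (intro measurable_component_singleton) auto
      then show "(\<lambda>\<omega>. \<omega> (i, b)) \<in> ?W \<rightarrow>\<^sub>M M i" by (simp add: N_def)
    qed
    then show ?thesis unfolding g_def by (intro measurable_Pair)
  qed
  have W: "distr (?P \<Otimes>\<^sub>M ?P) ?W (\<Phi> e) = ?W" for e
  proof (rule measure_eqI_PiM_infinite[symmetric, OF refl])
    show "finite_measure ?W" by unfold_locales
    fix A J assume J: "finite J" "J \<subseteq> ?K" and A: "\<And>k. k \<in> J \<Longrightarrow> A k \<in> sets (N k)"
    \<comment> \<open>The constraints of the cylinder are sorted by the point they restrict:
      \<open>J0\<close> collects those on \<open>x\<close>, \<open>J1\<close> those on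
      \<open>y\<close>.\<close>
    define J0 where "J0 = {i. (i, i \<in> e) \<in> J}"
    define J1 where "J1 = {i. (i, i \<notin> e) \<in> J}"
    have J': "J = (\<lambda>i. (i, i \<in> e)) ` J0 \<union> (\<lambda>i. (i, i \<notin> e)) ` J1"
    proof (rule set_eqI)
      fix k
      show "k \<in> J \<longleftrightarrow> k \<in> (\<lambda>i. (i, i \<in> e)) ` J0 \<union> (\<lambda>i. (i, i \<notin> e)) ` J1"
        by (cases k; cases "snd k = (fst k \<in> e)") (auto simp: J0_def J1_def image_iff)
    qed
    have fin: "finite J0" "finite J1"
      using finite_vimageI[OF J(1), of "\<lambda>i. (i, i \<in> e)"] finite_vimageI[OF J(1), of "\<lambda>i. (i, i \<notin> e)"]
      by (auto simp: J0_def J1_def inj_on_def vimage_def)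
    have sub: "J0 \<subseteq> I" "J1 \<subseteq> I" using J(2) by (auto simp: J0_def J1_def)
    have A0: "A (i, i \<in> e) \<in> sets (M i)" if "i \<in> J0" for i
      using A[of "(i, i \<in> e)"] that by (auto simp: J0_def N_def)
    have A1: "A (i, i \<notin> e) \<in> sets (M i)" if "i \<in> J1" for i
      using A[of "(i, i \<notin> e)"] that by (auto simp: J1_def N_def)
    define X where "X = prod_emb I M J0 (\<Pi>\<^sub>E i\<in>J0. A (i, i \<in> e))"
    define Y where "Y = prod_emb I M J1 (\<Pi>\<^sub>E i\<in>J1. A (i, i \<notin> e))"
    have XY: "X \<in> sets ?P" "Y \<in> sets ?P"
      unfolding X_def Y_def using fin sub A0 A1 by (auto intro!: sets_PiM_I)
    have vim: "\<Phi> e -` prod_emb ?K N J (Pi\<^sub>E J A) \<inter> space (?P \<Otimes>\<^sub>M ?P) = X \<times> Y"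
    proof -
      have 1: "\<Phi> e (x, y) \<in> prod_emb ?K N J (Pi\<^sub>E J A) \<longleftrightarrow>
          (\<forall>i\<in>J0. x i \<in> A (i, i \<in> e)) \<and> (\<forall>i\<in>J1. y i \<in> A (i, i \<notin> e))"
        if xy: "x \<in> space ?P" "y \<in> space ?P" for x y
      proof -
        have "\<Phi> e (x, y) \<in> space ?W"
          using xy by (intro measurable_space[OF \<Phi>]) (auto simp: space_pair_measure)
        then have "\<Phi> e (x, y) \<in> prod_emb ?K N J (Pi\<^sub>E J A) \<longleftrightarrow> (\<forall>k\<in>J. \<Phi> e (x, y) k \<in> A k)"
          using J(2) by (auto simp: prod_emb_def space_PiM PiE_iff restrict_def extensional_def)
        also have "\<dots> \<longleftrightarrow> (\<forall>i\<in>J0. x i \<in> A (i, i \<in> e)) \<and> (\<forall>i\<in>J1. y i \<in> A (i, i \<notin> e))"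
        proof -
          have "\<Phi> e (x, y) (i, i \<in> e) = x i" if "i \<in> J0" for i using that sub by (auto simp: \<Phi>_def)
          moreover have "\<Phi> e (x, y) (i, i \<notin> e) = y i" if "i \<in> J1" for i using that sub by (auto simp: \<Phi>_def)
          ultimately show ?thesis unfolding J' by (simp only: ball_Un ball_simps) simp
        qed
        finally show ?thesis .
      qed
      have 2: "x \<in> X \<longleftrightarrow> x \<in> space ?P \<and> (\<forall>i\<in>J0. x i \<in> A (i, i \<in> e))" for x
        using sub by (auto simp: X_def prod_emb_def space_PiM PiE_iff restrict_def extensional_def)
      have 3: "x \<in> Y \<longleftrightarrow> x \<in> space ?P \<and> (\<forall>i\<in>J1. x i \<in> A (i, i \<notin> e))" for x
        using sub by (auto simp: Y_def prod_emb_def space_PiM PiE_iff restrict_def extensional_def)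
      show ?thesis using 1 2 3 by (auto simp: space_pair_measure)
    qed
    have "emeasure ?W (prod_emb ?K N J (Pi\<^sub>E J A)) = (\<Prod>k\<in>J. emeasure (N k) (A k))"
      using J A M by (intro emeasure_PiM_emb) (auto simp: N_def)
    also have "\<dots> = (\<Prod>i\<in>J0. emeasure (M i) (A (i, i \<in> e))) * (\<Prod>i\<in>J1. emeasure (M i) (A (i, i \<notin> e)))"
      unfolding J' using fin
      by (subst prod.union_disjoint) (auto simp: prod.reindex inj_on_def N_def)
    also have "\<dots> = emeasure ?P X * emeasure ?P Y"
      unfolding X_def Y_def using fin sub A0 A1 M by (simp add: emeasure_PiM_emb)
    also have "\<dots> = emeasure (?P \<Otimes>\<^sub>M ?P) (X \<times> Y)"
      using XY by (simp add: P.emeasure_pair_measure_Times)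
    also have "\<dots> = emeasure (distr (?P \<Otimes>\<^sub>M ?P) ?W (\<Phi> e)) (prod_emb ?K N J (Pi\<^sub>E J A))"
      using J A by (subst emeasure_distr) (auto intro!: sets_PiM_I simp: vim)
    finally show "emeasure ?W (prod_emb ?K N J (Pi\<^sub>E J A)) =
      emeasure (distr (?P \<Otimes>\<^sub>M ?P) ?W (\<Phi> e)) (prod_emb ?K N J (Pi\<^sub>E J A))" .
  qed simp
  have "distr (?P \<Otimes>\<^sub>M ?P) (?P \<Otimes>\<^sub>M ?P) (g \<circ> \<Phi> e) = distr ?W (?P \<Otimes>\<^sub>M ?P) g" for e
    by (subst distr_distr[symmetric, OF g \<Phi>]) (simp add: W)
  moreover have "g \<circ> \<Phi> e = (\<lambda>(x, y). (mix I e x y, mix I e y x))" for e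
    by (auto simp: fun_eq_iff g_def \<Phi>_def mix_def)
  ultimately have eq: "distr (?P \<Otimes>\<^sub>M ?P) (?P \<Otimes>\<^sub>M ?P) (\<lambda>(x, y). (mix I e x y, mix I e y x)) =
      distr ?W (?P \<Otimes>\<^sub>M ?P) g" for e
    by metis
  \<comment> \<open>For \<open>e = {}\<close> nothing is swapped, so the common law is that of the
    original pair.\<close>
  have "distr (?P \<Otimes>\<^sub>M ?P) (?P \<Otimes>\<^sub>M ?P) (\<lambda>(x, y). (mix I {} x y, mix I {} y x)) =
      distr (?P \<Otimes>\<^sub>M ?P) (?P \<Otimes>\<^sub>M ?P) (\<lambda>z. z)"
    by (intro distr_cong) (auto simp: space_pair_measure space_PiM mix_def PiE_restrict)
  then show ?thesis using eq[of e] eq[of "{}"] by (simp add: distr_id)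
qed

text \<open>
  Swapping coordinates between two independent points \<open>x, y\<close> leaves their joint law unchanged, and for
  fixed \<open>x, y\<close> the swapped points range over a discrete cube, with \<open>mix I e y x\<close> antipodal to
  \<open>mix I e x y\<close>; so the discrete inequality can be averaged.
\<close>

lemma reimer_PiM:
  assumes M: "\<And>i. i \<in> I \<Longrightarrow> prob_space (M i)"
    and F: "finite F" "F \<subseteq> I"
    and A: "A \<in> sets (completion (PiM I M))"
    and B: "B \<in> sets (completion (PiM I M))"
    and C: "C \<in> sets (completion (PiM I M))"
    and B_F: "\<And>x y. x \<in> B \<Longrightarrow> y \<in> space (PiM I M) \<Longrightarrow> (\<And>i. i \<in> F \<Longrightarrow> y i = x i) \<Longrightarrow> y \<in> B"
    and sub: "\<And>x. x \<in> C \<Longrightarrow> \<exists>J\<subseteq>F.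
      (\<forall>y\<in>space (PiM I M). (\<forall>i\<in>J. y i = x i) \<longrightarrow> y \<in> A) \<and>
      (\<forall>y\<in>space (PiM I M). (\<forall>i\<in>F - J. y i = x i) \<longrightarrow> y \<in> B)"
  shows "emeasure (completion (PiM I M)) C \<le>
    emeasure (completion (PiM I M)) A * emeasure (completion (PiM I M)) B"
proof -
  let ?P = "PiM I M"
  let ?PP = "?P \<Otimes>\<^sub>M ?P"
  interpret P: prob_space ?P using M by (rule prob_space_PiM)
  interpret PP: pair_prob_space ?P ?P ..
  \<comment> \<open>Sets of the completion are replaced by sets of the product sigma-algebra with
    equal measure, enlarging \<open>A\<close> and \<open>B\<close> and shrinking \<open>C\<close>.
    Membership in \<open>A\<close>, \<open>B\<close>, \<open>C\<close> is still what the
    combinatorial argument uses.\<close>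
  obtain A' where A': "A' \<in> sets ?P" "A \<subseteq> A'" "emeasure (completion ?P) A = emeasure ?P A'"
    by (rule completion_upper[OF A]) (rule that)
  obtain B' where B': "B' \<in> sets ?P" "B \<subseteq> B'" "emeasure (completion ?P) B = emeasure ?P B'"
    by (rule completion_upper[OF B]) (rule that)
  define C' where "C' = main_part ?P C"
  have C': "C' \<in> sets ?P" "C' \<subseteq> C" "emeasure (completion ?P) C = emeasure ?P C'"
  proof -
    show "C' \<subseteq> C" using main_part_null_part_Un[OF C] unfolding C'_def by blast
  qed (simp_all add: C'_def C)
  obtain J where J: "\<And>x. x \<in> C \<Longrightarrow> J x \<subseteq> F"
    "\<And>x y. x \<in> C \<Longrightarrow> y \<in> space ?P \<Longrightarrow> (\<And>i. i \<in> J x \<Longrightarrow> y i = x i) \<Longrightarrow> y \<in> A"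
    "\<And>x y. x \<in> C \<Longrightarrow> y \<in> space ?P \<Longrightarrow> (\<And>i. i \<in> F - J x \<Longrightarrow> y i = x i) \<Longrightarrow> y \<in> B"
  proof -
    have "\<forall>x\<in>C. \<exists>J. J \<subseteq> F \<and> (\<forall>y\<in>space ?P. (\<forall>i\<in>J. y i = x i) \<longrightarrow> y \<in> A) \<and>
      (\<forall>y\<in>space ?P. (\<forall>i\<in>F - J. y i = x i) \<longrightarrow> y \<in> B)"
      using sub by (intro ballI) simp
    from bchoice[OF this] obtain J where "\<forall>x\<in>C. J x \<subseteq> F \<and> (\<forall>y\<in>space ?P. (\<forall>i\<in>J x. y i = x i) \<longrightarrow> y \<in> A) \<and>
      (\<forall>y\<in>space ?P. (\<forall>i\<in>F - J x. y i = x i) \<longrightarrow> y \<in> B)" ..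
    then show ?thesis by (intro that[of J]) simp_all
  qed
  define T where "T e = (\<lambda>(x, y). (mix I e x y, mix I e y x) :: ('a \<Rightarrow> 'b) \<times> ('a \<Rightarrow> 'b))" for e
  have T[measurable]: "T e \<in> ?PP \<rightarrow>\<^sub>M ?PP" for e
    using measurable_mix[of I e M] unfolding T_def split_beta by (intro measurable_Pair) auto
  have distr_T: "distr ?PP ?PP (T e) = ?PP" for e
    unfolding T_def using M by (rule distr_mix_pair_PiM)
  \<comment> \<open>Each swap preserves the joint law, so every summand has the same
    integral.\<close>
  have int: "(\<integral>\<^sup>+z. (\<Sum>e\<in>Pow F. indicator R (T e z)) \<partial>?PP) = of_nat (card (Pow F)) * emeasure ?PP R"
    if R[measurable]: "R \<in> sets ?PP" for R
  proof -
    have "(\<integral>\<^sup>+z. indicator R (T e z) \<partial>?PP) = emeasure ?PP R" for e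
    proof -
      have "(\<integral>\<^sup>+z. indicator R (T e z) \<partial>?PP) = (\<integral>\<^sup>+z. indicator R z \<partial>distr ?PP ?PP (T e))"
        by (subst nn_integral_distr) auto
      then show ?thesis by (simp add: distr_T)
    qed
    then show ?thesis by (subst nn_integral_sum) auto
  qed
  have pointwise: "card {e \<in> Pow F. mix I e x y \<in> C'} \<le> card {e \<in> Pow F. mix I e x y \<in> A' \<and> mix I e y x \<in> B'}"
    if xy: "x \<in> space ?P" "y \<in> space ?P" for x y
  proof -
    have sp: "mix I e x y \<in> space ?P" "mix I e y x \<in> space ?P" for e
      using xy by (auto simp: mix_def space_PiM PiE_iff)
    have agree: "mix I z x y i = mix I e x y i" if "z \<inter> K = e \<inter> K" "i \<in> K" for z e i K
      using that by (auto simp: mix_def)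
    have "card {e \<in> Pow F. mix I e x y \<in> C'} \<le>
        card {z \<in> Pow F. z \<in> {e. mix I e x y \<in> A} \<and> F - z \<in> {e. mix I e x y \<in> B}}"
    proof (rule reimer_butterfly[OF F(1), where J = "\<lambda>e. J (mix I e x y)"])
      fix e z assume e: "e \<in> {e \<in> Pow F. mix I e x y \<in> C'}" and "z \<subseteq> F"
      let ?J = "J (mix I e x y)"
      from e have eC: "mix I e x y \<in> C" using C' by auto
      show "z \<in> {e. mix I e x y \<in> A}" if "z \<inter> (F \<inter> ?J) = e \<inter> (F \<inter> ?J)"
        using J(1)[OF eC] J(2)[OF eC sp(1)] agree[OF that] by blast
      show "z \<in> {e. mix I e x y \<in> B}" if "z \<inter> (F - ?J) = e \<inter> (F - ?J)"
        using J(3)[OF eC sp(1)] agree[OF that] by blast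
    qed auto
    also have "\<dots> \<le> card {e \<in> Pow F. mix I e x y \<in> A' \<and> mix I e y x \<in> B'}"
    proof (rule card_mono)
      \<comment> \<open>The two points agree on \<open>F\<close> and may differ outside it; the
        transfer works because \<open>B\<close> depends on the coordinates in \<open>F\<close>
        only.\<close>
      have "mix I z y x \<in> B" if "mix I (F - z) x y \<in> B" for z
        using F(2) by (intro B_F[OF that sp(2)]) (auto simp: mix_def)
      then show "{z \<in> Pow F. z \<in> {e. mix I e x y \<in> A} \<and> F - z \<in> {e. mix I e x y \<in> B}}
          \<subseteq> {e \<in> Pow F. mix I e x y \<in> A' \<and> mix I e y x \<in> B'}"
        using A'(2) B'(2) by auto
    qed (use F in simp)
    finally show ?thesis .
  qed
  have "of_nat (card (Pow F)) * emeasure ?PP (C' \<times> space ?P) =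
      (\<integral>\<^sup>+z. (\<Sum>e\<in>Pow F. indicator (C' \<times> space ?P) (T e z)) \<partial>?PP)"
    using C' by (subst int) auto
  also have "\<dots> \<le> (\<integral>\<^sup>+z. (\<Sum>e\<in>Pow F. indicator (A' \<times> B') (T e z)) \<partial>?PP)"
  proof (rule nn_integral_mono)
    fix z assume z: "z \<in> space ?PP"
    then obtain x y where xy: "z = (x, y)" "x \<in> space ?P" "y \<in> space ?P" by (auto simp: space_pair_measure)
    have sp: "mix I e x y \<in> space ?P" "mix I e y x \<in> space ?P" for e
      using xy by (auto simp: mix_def space_PiM PiE_iff)
    have count: "(\<Sum>e\<in>Pow F. indicator R (T e z)) = of_nat (card {e \<in> Pow F. T e z \<in> R})" for R :: "_ set"
      using F(1) by (simp add: indicator_def sum.If_cases Int_def)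
    show "(\<Sum>e\<in>Pow F. indicator (C' \<times> space ?P) (T e z)) \<le> (\<Sum>e\<in>Pow F. indicator (A' \<times> B') (T e z) :: ennreal)"
      unfolding count using pointwise[OF xy(2,3)] sp by (simp add: T_def xy(1))
  qed
  also have "\<dots> = of_nat (card (Pow F)) * emeasure ?PP (A' \<times> B')"
    using A' B' by (subst int) auto
  \<comment> \<open>The number of swaps is positive and finite, so it cancels.\<close>
  finally have "emeasure ?PP (C' \<times> space ?P) \<le> emeasure ?PP (A' \<times> B')"
    using F(1) by (subst (asm) ennreal_mult_le_mult_iff) auto
  then show ?thesis
    using A' B' C' by (simp add: P.emeasure_pair_measure_Times P.emeasure_space_1)
qed

section \<open>Suslin sets\<close>

text \<open>Projections along Baire space of closed sets, that is, the results of the Souslin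
  operation on closed sets. In this form closure properties reduce to coding sequences.\<close>

definition suslin :: "'a::topological_space set \<Rightarrow> bool" where
  "suslin A \<longleftrightarrow> (\<exists>H :: ('a \<times> (nat \<Rightarrow> nat)) set. closed H \<and> A = fst ` H)"

lemma suslin_closed: "closed A \<Longrightarrow> suslin A"
  unfolding suslin_def by (intro exI[of _ "A \<times> UNIV"]) (auto intro: closed_Times simp: fst_image_times)

lemma closed_vimage_reindex:
  fixes H :: "('a::topological_space \<times> ('i \<Rightarrow> 'b::topological_space)) set"
    and \<pi> :: "'i \<Rightarrow> 'j"
  assumes "closed H"
  shows "closed {z. (fst z, \<lambda>k. snd z (\<pi> k)) \<in> H}"
proof -
  have "continuous_on UNIV (\<lambda>z :: 'a \<times> ('j \<Rightarrow> 'b). snd z i)" for i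
    by (rule continuous_on_product_then_coordinatewise) (intro continuous_intros)
  then have "continuous_on UNIV (\<lambda>z :: 'a \<times> ('j \<Rightarrow> 'b). (fst z, \<lambda>k. snd z (\<pi> k)))"
    by (intro continuous_intros)
  from closed_vimage[OF assms this] show ?thesis by (simp add: vimage_def)
qed

text \<open>The first entry of the sequence names the index \<open>n\<close>; the remaining entries
  are a witness for membership in \<open>A n\<close>.\<close>

lemma suslin_UN:
  assumes "\<And>n::nat. suslin (A n)"
  shows "suslin (\<Union>n. A n)"
proof -
  obtain H where H: "\<And>n. closed (H n :: ('a \<times> (nat \<Rightarrow> nat)) set)" "\<And>n. A n = fst ` H n"
    using assms unfolding suslin_def by metis
  \<comment> \<open>Written as an intersection of the implications "if the first entry is
    \<open>n\<close>, then the tail is a witness for \<open>n\<close>", each of which is a closed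
    condition because the entries are discrete.\<close>
  define G where "G = (\<Inter>n. {z :: 'a \<times> (nat \<Rightarrow> nat). snd z 0 \<in> - {n}} \<union> {z. (fst z, \<lambda>k. snd z (Suc k)) \<in> H n})"
  have cont: "continuous_on UNIV (\<lambda>z :: 'a \<times> (nat \<Rightarrow> nat). snd z 0)"
    by (rule continuous_on_product_then_coordinatewise) (intro continuous_intros)
  have "closed (- {n})" for n :: nat
    unfolding closed_def by (rule discrete_topology_class.open_discrete)
  then have "closed {z :: 'a \<times> (nat \<Rightarrow> nat). snd z 0 \<in> - {n}}" for n
    using closed_vimage[OF _ cont, of "- {n}"] by (simp add: vimage_def)
  then have "closed G"
    unfolding G_def using H(1) by (intro closed_INT ballI closed_Un closed_vimage_reindex)
  moreover have "(\<Union>n. A n) = fst ` G"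
  proof (intro equalityI subsetI)
    fix x assume "x \<in> (\<Union>n. A n)"
    then obtain n \<sigma> where "(x, \<sigma>) \<in> H n" by (auto simp: H(2))
    then have "(x, case_nat n \<sigma>) \<in> G" by (simp add: G_def)
    then show "x \<in> fst ` G" by force
  next
    fix x assume "x \<in> fst ` G"
    then obtain \<sigma> where "(x, \<sigma>) \<in> G" by force
    then have "(x, \<lambda>k. \<sigma> (Suc k)) \<in> H (\<sigma> 0)" by (auto simp: G_def)
    then show "x \<in> (\<Union>n. A n)" by (force simp: H(2))
  qed
  ultimately show ?thesis unfolding suslin_def by blast
qed

text \<open>Witnesses for all \<open>n\<close> are packed into one sequence by the pairing
  function.\<close>

lemma suslin_INT:
  assumes "\<And>n::nat. suslin (A n)"
  shows "suslin (\<Inter>n. A n)"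
proof -
  obtain H where H: "\<And>n. closed (H n :: ('a \<times> (nat \<Rightarrow> nat)) set)" "\<And>n. A n = fst ` H n"
    using assms unfolding suslin_def by metis
  define G where "G = (\<Inter>n. {z :: 'a \<times> (nat \<Rightarrow> nat). (fst z, \<lambda>k. snd z (prod_encode (n, k))) \<in> H n})"
  have "closed G"
    unfolding G_def using H(1) by (intro closed_INT ballI closed_vimage_reindex)
  moreover have "(\<Inter>n. A n) = fst ` G"
  proof (intro equalityI subsetI)
    fix x assume "x \<in> (\<Inter>n. A n)"
    then have "\<forall>n. \<exists>\<sigma>. (x, \<sigma>) \<in> H n" by (force simp: H(2))
    then obtain \<sigma> where "\<And>n. (x, \<sigma> n) \<in> H n" by metis
    then have "(x, \<lambda>m. case prod_decode m of (n, k) \<Rightarrow> \<sigma> n k) \<in> G" by (simp add: G_def)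
    then show "x \<in> fst ` G" by force
  next
    fix x assume "x \<in> fst ` G"
    then show "x \<in> (\<Inter>n. A n)" by (force simp: H(2) G_def)
  qed
  ultimately show ?thesis unfolding suslin_def by blast
qed

lemma compact_PiE_UNIV:
  fixes S :: "'i \<Rightarrow> 'a::topological_space set"
  assumes "\<And>i. compact (S i)"
  shows "compact {f. \<forall>i. f i \<in> S i}"
proof -
  have "compactin (product_topology (\<lambda>i. euclidean) UNIV) (PiE UNIV S)"
    using assms by (subst compactin_PiE) auto
  then show ?thesis
    by (simp add: euclidean_product_topology PiE_def Pi_def)
qed

text \<open>Projecting away the point \<open>x\<close> keeps the witnessing set closed: along a
  convergent sequence the points \<open>x\<close> stay in a compact set, so a subsequence of them
  converges too.\<close>

lemma suslin_Image_compact: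
  fixes A :: "'a::metric_space set" and R :: "('a \<times> 'b::metric_space) set"
  assumes "suslin A" "compact R"
  shows "suslin (R `` A)"
proof -
  obtain H :: "('a \<times> (nat \<Rightarrow> nat)) set" where H: "closed H" "A = fst ` H"
    using assms(1) unfolding suslin_def by blast
  define G where "G = {(y, \<sigma>). \<exists>x. (x, y) \<in> R \<and> (x, \<sigma>) \<in> H}"
  have "closed G"
    unfolding closed_sequential_limits
  proof safe
    fix f :: "nat \<Rightarrow> 'b \<times> (nat \<Rightarrow> nat)" and y \<sigma>
    assume f: "\<forall>n. f n \<in> G" "f \<longlonglongrightarrow> (y, \<sigma>)"
    from f(1) have "\<forall>n. \<exists>x. (x, fst (f n)) \<in> R \<and> (x, snd (f n)) \<in> H"
      unfolding G_def by (auto simp: split_beta)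
    then obtain g where g: "\<And>n. (g n, fst (f n)) \<in> R" "\<And>n. (g n, snd (f n)) \<in> H" by metis
    have "\<forall>n. (g n, fst (f n)) \<in> R" using g(1) by blast
    with compact_imp_seq_compact[OF assms(2)]
    obtain l r where l: "l \<in> R" "strict_mono r" "((\<lambda>n. (g n, fst (f n))) \<circ> r) \<longlonglongrightarrow> l"
      by (rule seq_compactE)
    have fr: "(f \<circ> r) \<longlonglongrightarrow> (y, \<sigma>)" using f(2) l(2) by (rule LIMSEQ_subseq_LIMSEQ)
    have 1: "(\<lambda>n. g (r n)) \<longlonglongrightarrow> fst l" "(\<lambda>n. fst (f (r n))) \<longlonglongrightarrow> snd l"
      using tendsto_fst[OF l(3)] tendsto_snd[OF l(3)] by (simp_all add: o_def)
    have 2: "(\<lambda>n. fst (f (r n))) \<longlonglongrightarrow> y" "(\<lambda>n. snd (f (r n))) \<longlonglongrightarrow> \<sigma>"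
      using tendsto_fst[OF fr] tendsto_snd[OF fr] by (simp_all add: o_def)
    have "snd l = y" using 1(2) 2(1) by (rule LIMSEQ_unique)
    moreover have "(fst l, \<sigma>) \<in> H"
      using closed_sequentially[OF H(1), of "\<lambda>n. (g (r n), snd (f (r n)))"] g(2) tendsto_Pair[OF 1(1) 2(2)]
      by blast
    ultimately show "(y, \<sigma>) \<in> G" using l(1) by (cases l) (auto simp: G_def)
  qed
  moreover have "R `` A = fst ` G"
    unfolding H(2) by (force simp: G_def)
  ultimately show ?thesis unfolding suslin_def by blast
qed

text \<open>
  Choquet's capacitability argument: bound the coordinates of the Baire sequences one after another,
  keeping the outer measure above \<open>c\<close>; compactness of the resulting box of sequences puts the
  intersection of the closures back into \<open>A\<close>.
\<close>

lemma suslin_inner_approximation: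
  fixes M :: "'a::metric_space measure"
  assumes M: "finite_measure M" and closed_space: "closed (space M)"
    and closed_sets: "\<And>C. closed C \<Longrightarrow> C \<subseteq> space M \<Longrightarrow> C \<in> sets M"
    and A: "suslin A" "A \<subseteq> space M" and c: "c < outer_measure_of M A"
  shows "\<exists>K\<in>sets M. K \<subseteq> A \<and> c \<le> emeasure M K"
proof -
  interpret finite_measure M by fact
  obtain H :: "('a \<times> (nat \<Rightarrow> nat)) set" where H: "closed H" "A = fst ` H"
    using A(1) unfolding suslin_def by blast
  \<comment> \<open>Entries are bounded rather than prescribed: the bounds give increasing unions
    for the outer measure and, in the end, a compact set of sequences.\<close>
  define B where "B k n = {x. \<exists>\<sigma>. (x, \<sigma>) \<in> H \<and> (\<forall>i<n. \<sigma> i \<le> k i)}" for k :: "nat \<Rightarrow> nat" and n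
  have B_A: "B k n \<subseteq> A" for k n unfolding B_def H(2) by force
  have B_cong: "B k n = B k' n" if "\<And>i. i < n \<Longrightarrow> k i = k' i" for k k' n
    using that by (simp add: B_def)
  have "\<exists>f. \<forall>n. c < outer_measure_of M (B (f n) n) \<and> (\<forall>i<n. f (Suc n) i = f n i)"
  proof (rule dependent_nat_choice)
    have "B (\<lambda>_. 0) 0 = A" unfolding B_def H(2) by force
    then show "\<exists>f. c < outer_measure_of M (B f 0)" using c by metis
  next
    fix f n assume f: "c < outer_measure_of M (B f n)"
    have inc: "incseq (\<lambda>m. B (f(n := m)) (Suc n))"
    proof (rule incseq_SucI)
      fix m
      show "B (f(n := m)) (Suc n) \<le> B (f(n := Suc m)) (Suc n)"
      proof
        fix x assume "x \<in> B (f(n := m)) (Suc n)"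
        then obtain \<sigma> where "(x, \<sigma>) \<in> H" "\<forall>i<Suc n. \<sigma> i \<le> (f(n := m)) i" unfolding B_def by blast
        then have "(x, \<sigma>) \<in> H \<and> (\<forall>i<Suc n. \<sigma> i \<le> (f(n := Suc m)) i)" by (auto simp: less_Suc_eq)
        then show "x \<in> B (f(n := Suc m)) (Suc n)" unfolding B_def by blast
      qed
    qed
    have "(\<Union>m. B (f(n := m)) (Suc n)) = B f n"
      unfolding B_def by (auto simp: less_Suc_eq)
    \<comment> \<open>Outer measure is continuous along increasing sequences of arbitrary sets, so
      some finite bound on entry \<open>n\<close> keeps it above \<open>c\<close>.\<close>
    moreover have "(SUP m. outer_measure_of M (B (f(n := m)) (Suc n))) =
        outer_measure_of M (\<Union>m. B (f(n := m)) (Suc n))"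
      using B_A A(2) by (intro SUP_outer_measure_of_incseq inc) blast
    ultimately have "c < (SUP m. outer_measure_of M (B (f(n := m)) (Suc n)))" using f by simp
    then obtain m where "c < outer_measure_of M (B (f(n := m)) (Suc n))"
      unfolding less_SUP_iff by blast
    then show "\<exists>g. c < outer_measure_of M (B g (Suc n)) \<and> (\<forall>i<n. g i = f i)"
      by (intro exI[of _ "f(n := m)"]) simp
  qed
  then obtain f where f: "\<And>n. c < outer_measure_of M (B (f n) n)" "\<And>n i. i < n \<Longrightarrow> f (Suc n) i = f n i"
    by blast
  \<comment> \<open>The functions \<open>f n\<close> stabilize below \<open>n\<close>;
    \<open>k\<close> is their diagonal limit.\<close>
  define k where "k i = f (Suc i) i" for i
  have "f n i = k i" if "i < n" for i n
    using that by (induction n) (auto simp: k_def less_Suc_eq f(2))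
  then have B_k: "B (f n) n = B k n" for n by (intro B_cong) auto
  define K where "K = (\<Inter>n. closure (B k n))"
  have cl: "closure (B k n) \<subseteq> space M" for n
    using B_A[of k n] A(2) closed_space by (intro closure_minimal) auto
  have cl_sets: "closure (B k n) \<in> sets M" for n
    using cl by (intro closed_sets) auto
  have "K \<in> sets M" unfolding K_def using cl_sets by blast
  moreover have "K \<subseteq> A"
  proof
    fix x assume x: "x \<in> K"
    have "\<exists>y \<sigma>. dist y x < inverse (Suc n) \<and> (y, \<sigma>) \<in> H \<and> (\<forall>i<n. \<sigma> i \<le> k i)" for n
    proof -
      have "x \<in> closure (B k n)" using x by (auto simp: K_def)
      then obtain y where "y \<in> B k n" "dist y x < inverse (Suc n)"
        unfolding closure_approachable by (meson inverse_positive_iff_positive of_nat_0_less_iff zero_less_Suc)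
      then show ?thesis by (auto simp: B_def)
    qed
    then obtain y \<sigma> where y: "\<And>n. dist (y n) x < inverse (Suc n)" "\<And>n. (y n, \<sigma> n) \<in> H"
      "\<And>n i. i < n \<Longrightarrow> \<sigma> n i \<le> k i" by metis
    have "y \<longlonglongrightarrow> x"
      unfolding tendsto_dist_iff[of y]
      by (rule tendsto_sandwich[OF _ _ tendsto_const LIMSEQ_inverse_real_of_nat])
         (use y(1) in \<open>auto intro!: always_eventually less_imp_le\<close>)
    \<comment> \<open>The bound \<open>k i\<close> holds for \<open>\<sigma> n i\<close> only when
      \<open>n > i\<close>; the finitely many earlier values are added by hand, so that
      \<open>S i\<close> is finite and contains all of them.\<close>
    define S where "S i = {..k i} \<union> (\<lambda>n. \<sigma> n i) ` {..i}" for i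
    have "seq_compact {f. \<forall>i. f i \<in> S i}"
      by (intro compact_imp_seq_compact compact_PiE_UNIV finite_imp_compact) (simp add: S_def)
    moreover have "\<forall>n. \<sigma> n \<in> {f. \<forall>i. f i \<in> S i}"
      using y(3) by (auto simp: S_def not_le[symmetric])
    ultimately obtain l r where l: "strict_mono r" "(\<sigma> \<circ> r) \<longlonglongrightarrow> l"
      by (rule seq_compactE)
    have "(y \<circ> r) \<longlonglongrightarrow> x" using \<open>y \<longlonglongrightarrow> x\<close> l(1) by (rule LIMSEQ_subseq_LIMSEQ)
    from tendsto_Pair[OF this l(2)] have "(x, l) \<in> H"
      using closed_sequentially[OF H(1), of "\<lambda>n. ((y \<circ> r) n, (\<sigma> \<circ> r) n)"] y(2) by simp
    then show "x \<in> A" unfolding H(2) by force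
  qed
  moreover have "c \<le> emeasure M K"
  proof -
    have "decseq (\<lambda>n. closure (B k n))"
      unfolding decseq_def by (intro allI impI closure_mono) (force simp: B_def)
    then have "emeasure M K = (INF n. emeasure M (closure (B k n)))"
      unfolding K_def using cl_sets by (intro INF_emeasure_decseq[symmetric]) auto
    also have "c \<le> \<dots>"
    proof (rule INF_greatest)
      fix n
      have "c \<le> outer_measure_of M (B k n)" using f(1)[of n] unfolding B_k by simp
      also have "\<dots> \<le> outer_measure_of M (closure (B k n))"
        by (intro outer_measure_of_mono closure_subset)
      finally show "c \<le> emeasure M (closure (B k n))" using cl_sets by simp
    qed
    finally show ?thesis .
  qed
  ultimately show ?thesis by blast
qed

text \<open>A countable union of inner approximations has the measure of a measurable hull of
  \<open>A\<close>, so \<open>A\<close> is sandwiched between measurable sets of equal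
  measure.\<close>

lemma suslin_sets_completion:
  fixes M :: "'a::metric_space measure"
  assumes M: "finite_measure M" and closed_space: "closed (space M)"
    and closed_sets: "\<And>C. closed C \<Longrightarrow> C \<subseteq> space M \<Longrightarrow> C \<in> sets M"
    and A: "suslin A" "A \<subseteq> space M"
  shows "A \<in> sets (completion M)"
proof -
  interpret finite_measure M by fact
  obtain E where E: "E \<in> sets M" "A \<subseteq> E" "outer_measure_of M A = emeasure M E"
    using outer_measure_of_attain[OF A(2)] by blast
  have "\<exists>K\<in>sets M. K \<subseteq> A \<and> measure M E - inverse (Suc n) \<le> measure M K" for n
  \<comment> \<open>Inner approximation requires a level strictly below the outer measure. There is
    none if that is 0, and the empty set serves instead.\<close>
  proof (cases "measure M E = 0")
    case True
    then show ?thesis by (intro bexI[of _ "{}"]) auto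
  next
    case False
    then have "ennreal (measure M E - inverse (Suc n)) < outer_measure_of M A"
      unfolding E(3) emeasure_eq_measure
      by (intro ennreal_lessI) (auto simp: zero_less_measure_iff)
    from suslin_inner_approximation[OF M closed_space closed_sets A this]
    show ?thesis
      by (simp add: emeasure_eq_measure)
  qed
  then obtain K where K: "\<And>n. K n \<in> sets M" "\<And>n. K n \<subseteq> A"
      "\<And>n. measure M E - inverse (Suc n) \<le> measure M (K n)" by metis
  have U: "(\<Union>n. K n) \<in> sets M" "(\<Union>n. K n) \<subseteq> A" using K by auto
  have "measure M E \<le> measure M (\<Union>n. K n)"
  proof (rule LIMSEQ_le_const2)
    show "(\<lambda>n. measure M E - inverse (Suc n)) \<longlonglongrightarrow> measure M E"
      using tendsto_diff[OF tendsto_const LIMSEQ_inverse_real_of_nat, of "measure M E"] by simp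
    show "\<exists>N. \<forall>n\<ge>N. measure M E - inverse (Suc n) \<le> measure M (\<Union>n. K n)"
      using K(3) finite_measure_mono[OF _ U(1), of "K _"] by (meson SUP_upper UNIV_I order_trans)
  qed
  moreover have "measure M (\<Union>n. K n) \<le> measure M E"
    using U E by (intro finite_measure_mono) auto
  ultimately have "emeasure M (\<Union>n. K n) = emeasure M E" by (simp add: emeasure_eq_measure)
  then show ?thesis
    using U E by (intro completion.complete_sets_sandwich[OF _ _ U(2) E(2)]) (auto simp: less_top[symmetric])
qed

section \<open>Topology and Borel sets of the infinite cube, measurability of cylinder
  kernels\<close>

text \<open>With the one-point factor at the junk index 0 the cube becomes a product over the whole
  index type, so that Tychonoff's theorem applies in the topology of the function type.\<close>

lemma unit_cube_conv: "unit_cube = {f. \<forall>i. f i \<in> (if i = 0 then {undefined} else {0..1})}"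
proof (intro set_eqI iffI)
  fix f :: "nat \<Rightarrow> real"
  assume f: "f \<in> {f. \<forall>i. f i \<in> (if i = 0 then {undefined} else {0..1})}"
  have "f i = undefined" if "i \<notin> {1..}" for i
  proof -
    have "i = 0" using that by simp
    then show ?thesis using f by (auto dest: spec[of _ 0])
  qed
  moreover have "f i \<in> {0..1}" if "i \<in> {1..}" for i
    using f that by (auto dest: spec[of _ i])
  ultimately show "f \<in> unit_cube" unfolding unit_cube_def by blast
next
  fix f assume "f \<in> unit_cube"
  then show "f \<in> {f. \<forall>i. f i \<in> (if i = 0 then {undefined} else {0..1})}"
    by (auto simp: unit_cube_def PiE_iff extensional_def)
qed

lemma compact_unit_cube: "compact unit_cube"
  unfolding unit_cube_conv by (intro compact_PiE_UNIV) auto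

lemma continuous_on_apply: "continuous_on S (\<lambda>f. f i)"
  by (rule continuous_on_product_then_coordinatewise) (rule continuous_on_id)

lemma closed_imp_sets_cube_measure:
  assumes "closed C" "C \<subseteq> unit_cube"
  shows "C \<in> sets cube_measure"
proof -
  have "(\<lambda>f. f) \<in> borel_measurable cube_measure"
  proof (rule measurable_coordinatewise_then_product)
    fix i :: nat
    show "(\<lambda>f. f i) \<in> borel_measurable cube_measure"
    proof (cases "i = 0")
      \<comment> \<open>On the cube the coordinate 0 is constant.\<close>
      case True
      have "(\<lambda>_. undefined) \<in> borel_measurable cube_measure" by simp
      then show ?thesis
        by (rule measurable_cong[THEN iffD1, rotated])
          (auto simp: True space_cube_measure unit_cube_conv dest: spec[of _ 0])
    next
      case False
      then have "(\<lambda>f. f i) \<in> cube_measure \<rightarrow>\<^sub>M restrict_space lborel {0..1}"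
        unfolding cube_measure_def by (intro measurable_component_singleton) auto
      then show ?thesis by (simp add: measurable_restrict_space2_iff)
    qed
  qed
  from measurable_sets[OF this borel_closed[OF assms(1)]] show ?thesis
    using assms(2) by (simp add: space_cube_measure Int_absorb2)
qed

text \<open>The sets that are Suslin together with their complements form a sigma-algebra, and all
  coordinates are measurable for it. Complements are built in because the Suslin sets alone need not
  be closed under them.\<close>

lemma suslin_cube_measure:
  assumes "A \<in> sets cube_measure"
  shows "suslin A"
proof -
  define G where "G = {A. A \<subseteq> unit_cube \<and> suslin A \<and> suslin (unit_cube - A)}"
  interpret G: sigma_algebra unit_cube G
    unfolding sigma_algebra_iff2
  proof (intro conjI ballI allI impI)
    show "{} \<in> G"
      using suslin_closed[OF compact_imp_closed[OF compact_unit_cube]] suslin_closed[OF closed_empty]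
      by (simp add: G_def)
    show "unit_cube - s \<in> G" if "s \<in> G" for s
      using that by (auto simp: G_def double_diff)
    show "(\<Union>i. A i) \<in> G" if "range A \<subseteq> G" for A :: "nat \<Rightarrow> _"
    proof -
      have A: "A i \<subseteq> unit_cube" "suslin (A i)" "suslin (unit_cube - A i)" for i
        using that by (auto simp: G_def)
      have "unit_cube - (\<Union>i. A i) = (\<Inter>i. unit_cube - A i)" by auto
      then show ?thesis
        using A suslin_UN[of A] suslin_INT[of "\<lambda>i. unit_cube - A i"] by (auto simp: G_def)
    qed
  qed (auto simp: G_def)
  let ?S = "sigma unit_cube G"
  have S: "space ?S = unit_cube" "sets ?S = G"
    by (simp_all add: G.sets_measure_of_eq G.space_measure_of_eq)
  have "(\<lambda>f. f i) \<in> ?S \<rightarrow>\<^sub>M restrict_space lborel {0..1}" if "i \<in> {1..}" for i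
  proof -
    have "(\<lambda>f. f i) \<in> borel_measurable ?S"
    proof (rule borel_measurableI_le)
      fix y :: real
      have "closed {f \<in> unit_cube. f i \<le> y}"
        using continuous_on_closed_Collect_le compact_unit_cube continuous_on_apply
        by (intro continuous_on_closed_Collect_le) (auto intro: compact_imp_closed)
      moreover have "suslin (unit_cube - {f \<in> unit_cube. f i \<le> y})"
      proof -
        have "unit_cube - {f \<in> unit_cube. f i \<le> y} = (\<Union>n. {f \<in> unit_cube. y + inverse (Suc n) \<le> f i})"
        proof (intro equalityI subsetI)
          fix f assume f: "f \<in> unit_cube - {f \<in> unit_cube. f i \<le> y}"
          then obtain n where "inverse (Suc n) < f i - y"
            using reals_Archimedean[of "f i - y"] by auto
          then have "y + inverse (Suc n) \<le> f i" by simp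
          then show "f \<in> (\<Union>n. {f \<in> unit_cube. y + inverse (Suc n) \<le> f i})" using f by blast
        next
          fix f assume "f \<in> (\<Union>n. {f \<in> unit_cube. y + inverse (Suc n) \<le> f i})"
          then obtain n where n: "f \<in> unit_cube" "y + inverse (Suc n) \<le> f i" by blast
          have "0 < inverse (real (Suc n))" by simp
          with n(2) have "y < f i" by linarith
          with n(1) show "f \<in> unit_cube - {f \<in> unit_cube. f i \<le> y}" by simp
        qed
        moreover have "closed {f \<in> unit_cube. y + inverse (Suc n) \<le> f i}" for n
          using compact_unit_cube continuous_on_apply
          by (intro continuous_on_closed_Collect_le) (auto intro: compact_imp_closed)
        ultimately show ?thesis
          using suslin_UN[of "\<lambda>n. {f \<in> unit_cube. y + inverse (Suc n) \<le> f i}"]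
          by (simp add: suslin_closed)
      qed
      ultimately show "{f \<in> space ?S. f i \<le> y} \<in> sets ?S"
        unfolding S by (auto simp: G_def suslin_closed)
    qed
    moreover have "f i \<in> {0..1}" if "f \<in> unit_cube" for f
      using that \<open>i \<in> {1..}\<close> by (auto simp: unit_cube_def)
    ultimately show ?thesis
      by (auto simp: measurable_restrict_space2_iff S(1))
  qed
  moreover have "(\<lambda>\<omega> i. \<omega> i) \<in> space ?S \<rightarrow> (\<Pi>\<^sub>E i\<in>{1..}. space (restrict_space lborel {0..1}))"
    unfolding S(1) by (auto simp: unit_cube_def space_restrict_space)
  ultimately have "(\<lambda>f i. f i) \<in> ?S \<rightarrow>\<^sub>M cube_measure"
    unfolding cube_measure_def by (rule measurable_PiM_single'[where f = "\<lambda>i f. f i"])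
  from measurable_sets[OF this assms] have "A \<inter> unit_cube \<in> G" by (simp add: S)
  moreover have "A \<subseteq> unit_cube" using sets.sets_into_space[OF assms] by (simp add: space_cube_measure)
  ultimately show ?thesis by (simp add: G_def Int_absorb2)
qed

text \<open>The complement of the kernel is the image of the complement of \<open>A\<close> under
  the relation "agree on \<open>K\<close>", which is compact on the cube.\<close>

lemma cyl_kernel_measurable:
  assumes "A \<in> sets cube_measure"
  shows "[A]\<^bsub>K\<^esub> \<in> sets (completion cube_measure)"
proof -
  interpret prob_space cube_measure by (rule prob_space_cube_measure)
  define R where "R = {z \<in> unit_cube \<times> unit_cube. \<forall>i\<in>K. fst z i = snd z i}"
  have "closed {z :: (nat \<Rightarrow> real) \<times> (nat \<Rightarrow> real). fst z i = snd z i}" for i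
  proof (rule closed_Collect_eq)
    show "continuous_on UNIV (\<lambda>z :: (nat \<Rightarrow> real) \<times> (nat \<Rightarrow> real). fst z i)"
      by (rule continuous_on_product_then_coordinatewise) (intro continuous_intros)
    show "continuous_on UNIV (\<lambda>z :: (nat \<Rightarrow> real) \<times> (nat \<Rightarrow> real). snd z i)"
      by (rule continuous_on_product_then_coordinatewise) (intro continuous_intros)
  qed
  then have "closed (\<Inter>i\<in>K. {z :: (nat \<Rightarrow> real) \<times> (nat \<Rightarrow> real). fst z i = snd z i})" by auto
  from compact_Int_closed[OF compact_Times[OF compact_unit_cube compact_unit_cube] this]
  have "compact R" by (rule back_subst[of compact]) (auto simp: R_def)
  moreover have "suslin (unit_cube - A)"
    using sets.compl_sets[OF assms] by (intro suslin_cube_measure) (simp add: space_cube_measure)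
  ultimately have "suslin (R `` (unit_cube - A))" by (intro suslin_Image_compact)
  then have "R `` (unit_cube - A) \<in> sets (completion cube_measure)"
    by (rule suslin_sets_completion[rotated 3])
       (auto simp: space_cube_measure R_def finite_measure_axioms
          intro: closed_imp_sets_cube_measure compact_imp_closed compact_unit_cube)
  then have "unit_cube - R `` (unit_cube - A) \<in> sets (completion cube_measure)"
    using sets.compl_sets[of _ "completion cube_measure"] by (simp add: space_cube_measure)
  also have "unit_cube - R `` (unit_cube - A) = [A]\<^bsub>K\<^esub>"
    by (auto simp: R_def cyl_kernel_def Cyl_def)
  finally show ?thesis .
qed

section \<open>Disjoint occurrence in the infinite cube\<close>

lemma cyl_kernel_subset: "[A]\<^bsub>K\<^esub> \<subseteq> A"
  by (auto simp: cyl_kernel_def Cyl_def)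

lemma cyl_kernel_mono: "K \<subseteq> L \<Longrightarrow> [A]\<^bsub>K\<^esub> \<subseteq> [A]\<^bsub>L\<^esub>"
  by (fastforce simp: cyl_kernel_def Cyl_def)

lemma cyl_kernel_cong:
  assumes "x \<in> [A]\<^bsub>K\<^esub>" "y \<in> unit_cube" "\<And>i. i \<in> K \<Longrightarrow> y i = x i"
  shows "y \<in> [A]\<^bsub>K\<^esub>"
  using assms by (auto simp: cyl_kernel_def Cyl_def)

section \<open>Disjoint occurrence with reasons in a finite coordinate set\<close>

definition Disj_occ_within :: "nat set \<Rightarrow> nat \<Rightarrow> (nat \<Rightarrow> (nat \<Rightarrow> real) set) \<Rightarrow> (nat \<Rightarrow> real) set" where
  "Disj_occ_within F r A = {x. \<exists>J. (\<forall>i\<in>{1..r}. J i \<subseteq> F \<and> x \<in> [A i]\<^bsub>J i\<^esub>) \<and> disjoint_family_on J {1..r}}"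

lemma Disj_occ_within_mono:
  assumes "F \<subseteq> G"
  shows "Disj_occ_within F r A \<subseteq> Disj_occ_within G r A"
proof
  fix x assume "x \<in> Disj_occ_within F r A"
  then obtain J where "\<forall>i\<in>{1..r}. J i \<subseteq> F \<and> x \<in> [A i]\<^bsub>J i\<^esub>" "disjoint_family_on J {1..r}"
    unfolding Disj_occ_within_def by blast
  moreover from this assms have "\<forall>i\<in>{1..r}. J i \<subseteq> G \<and> x \<in> [A i]\<^bsub>J i\<^esub>" by blast
  ultimately show "x \<in> Disj_occ_within G r A" unfolding Disj_occ_within_def by blast
qed

lemma Disj_occ_within_measurable:
  assumes "finite F" "r \<ge> 1" and A: "\<And>i. i \<in> {1..r} \<Longrightarrow> A i \<in> sets cube_measure"
  shows "Disj_occ_within F r A \<in> sets (completion cube_measure)"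
proof -
  \<comment> \<open>Extensional choices of reasons, of which there are finitely many.\<close>
  let ?\<J> = "{J \<in> {1..r} \<rightarrow>\<^sub>E Pow F. disjoint_family_on J {1..r}}"
  have "Disj_occ_within F r A = (\<Union>J\<in>?\<J>. \<Inter>i\<in>{1..r}. [A i]\<^bsub>J i\<^esub>)"
  proof (intro equalityI subsetI)
    fix x assume "x \<in> Disj_occ_within F r A"
    then obtain J where J: "\<forall>i\<in>{1..r}. J i \<subseteq> F \<and> x \<in> [A i]\<^bsub>J i\<^esub>" "disjoint_family_on J {1..r}"
      unfolding Disj_occ_within_def by blast
    then have "restrict J {1..r} \<in> ?\<J>" by (auto simp: disjoint_family_on_def)
    moreover have "x \<in> (\<Inter>i\<in>{1..r}. [A i]\<^bsub>restrict J {1..r} i\<^esub>)" using J by auto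
    ultimately show "x \<in> (\<Union>J\<in>?\<J>. \<Inter>i\<in>{1..r}. [A i]\<^bsub>J i\<^esub>)" by blast
  next
    fix x assume "x \<in> (\<Union>J\<in>?\<J>. \<Inter>i\<in>{1..r}. [A i]\<^bsub>J i\<^esub>)"
    then show "x \<in> Disj_occ_within F r A" unfolding Disj_occ_within_def by blast
  qed
  also have "\<dots> \<in> sets (completion cube_measure)"
  proof (rule sets.finite_UN)
    show "finite ?\<J>"
      using assms(1) by (intro finite_subset[OF _ finite_PiE[of "{1..r}" "\<lambda>_. Pow F"]]) auto
    show "(\<Inter>i\<in>{1..r}. [A i]\<^bsub>J i\<^esub>) \<in> sets (completion cube_measure)" for J
      using assms(2) A by (intro sets.finite_INT cyl_kernel_measurable) auto
  qed
  finally show ?thesis .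
qed

text \<open>Induction on \<open>r\<close>: the reasons for the first \<open>r\<close> sets together
  form one reason for their disjoint occurrence, so Reimer's inequality for two sets splits off the
  last one.\<close>

lemma Disj_occ_within_emeasure:
  assumes F: "finite F" "F \<subseteq> {1..}" and "r \<ge> 1"
    and A: "\<And>i. i \<in> {1..r} \<Longrightarrow> A i \<in> sets cube_measure"
  shows "emeasure (completion cube_measure) (Disj_occ_within F r A) \<le> (\<Prod>i\<in>{1..r}. emeasure cube_measure (A i))"
  using \<open>r \<ge> 1\<close> A
proof (induction r rule: dec_induct)
  case base
  have "emeasure (completion cube_measure) (Disj_occ_within F 1 A) \<le> emeasure (completion cube_measure) (A 1)"
    using base.prems cyl_kernel_subset by (intro emeasure_mono) (auto simp: Disj_occ_within_def)
  then show ?case using base.prems by simp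
next
  case (step r)
  let ?C = "completion cube_measure"
  have A: "A i \<in> sets cube_measure" if "i \<in> {1..Suc r}" for i using step.prems that by blast
  \<comment> \<open>The last set is replaced by its kernel over \<open>F\<close>, which depends on
    the coordinates in \<open>F\<close> only, as \<open>reimer_PiM\<close> demands of its second
    set.\<close>
  have "emeasure ?C (Disj_occ_within F (Suc r) A) \<le>
      emeasure ?C (Disj_occ_within F r A) * emeasure ?C ([A (Suc r)]\<^bsub>F\<^esub>)"
    unfolding cube_measure_def
  proof (rule reimer_PiM[OF _ F], unfold cube_measure_def[symmetric] space_cube_measure)
    show "prob_space (restrict_space lborel {0..1::real})"
      by (intro prob_spaceI) (simp add: space_restrict_space emeasure_restrict_space)
    show "Disj_occ_within F r A \<in> sets ?C" "Disj_occ_within F (Suc r) A \<in> sets ?C"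
      using A F(1) step.hyps by (auto intro!: Disj_occ_within_measurable)
    show "[A (Suc r)]\<^bsub>F\<^esub> \<in> sets ?C" using A by (intro cyl_kernel_measurable) simp
    show "y \<in> [A (Suc r)]\<^bsub>F\<^esub>"
      if "x \<in> [A (Suc r)]\<^bsub>F\<^esub>" "y \<in> unit_cube" "\<And>i. i \<in> F \<Longrightarrow> y i = x i" for x y
      using that by (rule cyl_kernel_cong)
    fix x assume "x \<in> Disj_occ_within F (Suc r) A"
    then obtain J where J: "\<And>i. i \<in> {1..Suc r} \<Longrightarrow> J i \<subseteq> F"
      "\<And>i. i \<in> {1..Suc r} \<Longrightarrow> x \<in> [A i]\<^bsub>J i\<^esub>" "disjoint_family_on J {1..Suc r}"
      unfolding Disj_occ_within_def by blast
    define L where "L = (\<Union>i\<in>{1..r}. J i)"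
    have "L \<subseteq> F" using J(1) by (force simp: L_def)
    moreover have "y \<in> Disj_occ_within F r A"
      if y: "y \<in> unit_cube" "\<forall>i\<in>L. y i = x i" for y
    proof -
      have "y \<in> [A i]\<^bsub>J i\<^esub>" if "i \<in> {1..r}" for i
        using that y by (intro cyl_kernel_cong[OF J(2)]) (auto simp: L_def)
      moreover have "disjoint_family_on J {1..r}"
        using J(3) by (rule disjoint_family_on_mono[rotated]) auto
      moreover have "\<forall>i\<in>{1..r}. J i \<subseteq> F" using J(1) by simp
      ultimately show ?thesis unfolding Disj_occ_within_def by blast
    qed
    moreover have "y \<in> [A (Suc r)]\<^bsub>F\<^esub>"
      if y: "y \<in> unit_cube" "\<forall>i\<in>F - L. y i = x i" for y
    proof -
      have "J (Suc r) \<inter> J i = {}" if "i \<in> {1..r}" for i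
        using disjoint_family_onD[OF J(3), of "Suc r" i] that by auto
      \<comment> \<open>By disjointness the last reason survives any change of coordinates in
        \<open>L\<close>.\<close>
      then have "J (Suc r) \<subseteq> F - L" using J(1)[of "Suc r"] unfolding L_def by auto blast
      with y have "y \<in> [A (Suc r)]\<^bsub>J (Suc r)\<^esub>"
        by (intro cyl_kernel_cong[OF J(2)[of "Suc r"]]) auto
      then show ?thesis using cyl_kernel_mono[OF J(1)[of "Suc r"]] by auto
    qed
    ultimately show "\<exists>J\<subseteq>F. (\<forall>y\<in>unit_cube. (\<forall>i\<in>J. y i = x i) \<longrightarrow> y \<in> Disj_occ_within F r A) \<and>
        (\<forall>y\<in>unit_cube. (\<forall>i\<in>F - J. y i = x i) \<longrightarrow> y \<in> [A (Suc r)]\<^bsub>F\<^esub>)"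
      by (intro exI[of _ L]) simp
  qed
  also have "\<dots> \<le> (\<Prod>i\<in>{1..r}. emeasure cube_measure (A i)) * emeasure ?C (A (Suc r))"
    using A by (intro mult_mono step.IH emeasure_mono cyl_kernel_subset) auto
  also have "\<dots> = (\<Prod>i\<in>{1..Suc r}. emeasure cube_measure (A i))"
    using A[of "Suc r"] step.hyps by (simp add: prod.nat_ivl_Suc')
  finally show ?case .
qed

section \<open>Passage to arbitrary finite reasons\<close>

lemma mem_Disj_occ_iff:
  "x \<in> Disj_occ r A \<longleftrightarrow> (\<exists>J. (\<forall>i\<in>{1..r}. J i \<subseteq> {1..} \<and> finite (J i) \<and> x \<in> [A i]\<^bsub>J i\<^esub>) \<and>
     disjoint_family_on J {1..r})"
  unfolding Disj_occ_def by blast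

lemma mem_disj_occ_iff:
  "x \<in> A \<box> B \<longleftrightarrow> (\<exists>J K. J \<subseteq> {1..} \<and> K \<subseteq> {1..} \<and> finite J \<and> finite K \<and> J \<inter> K = {} \<and>
     x \<in> [A]\<^bsub>J\<^esub> \<and> x \<in> [B]\<^bsub>K\<^esub>)"
  unfolding disj_occ_def by blast

lemma Disj_occ_conv_within: "Disj_occ r A = (\<Union>n. Disj_occ_within {1..n} r A)" if "r \<ge> 1"
proof (intro equalityI subsetI)
  fix x assume "x \<in> Disj_occ r A"
  then obtain J where J: "\<And>i. i \<in> {1..r} \<Longrightarrow> J i \<subseteq> {1..} \<and> finite (J i)" "disjoint_family_on J {1..r}"
    "\<And>i. i \<in> {1..r} \<Longrightarrow> x \<in> [A i]\<^bsub>J i\<^esub>"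
    unfolding mem_Disj_occ_iff by blast
  have "finite (\<Union>i\<in>{1..r}. J i)" using J(1) by blast
  then obtain n where n: "(\<Union>i\<in>{1..r}. J i) \<subseteq> {..n}" unfolding finite_nat_iff_bounded_le by blast
  have "J i \<subseteq> {1..n}" if "i \<in> {1..r}" for i using n J(1)[OF that] that by fastforce
  then show "x \<in> (\<Union>n. Disj_occ_within {1..n} r A)"
    using J unfolding Disj_occ_within_def by blast
next
  fix x assume "x \<in> (\<Union>n. Disj_occ_within {1..n} r A)"
  then obtain n J where J: "\<And>i. i \<in> {1..r} \<Longrightarrow> J i \<subseteq> {1..n}" "disjoint_family_on J {1..r}"
    "\<And>i. i \<in> {1..r} \<Longrightarrow> x \<in> [A i]\<^bsub>J i\<^esub>"
    unfolding Disj_occ_within_def by blast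
  have "J i \<subseteq> {1..} \<and> finite (J i)" if "i \<in> {1..r}" for i
    using J(1)[OF that] by (auto intro: finite_subset)
  then show "x \<in> Disj_occ r A"
    using J unfolding mem_Disj_occ_iff by blast
qed

text \<open>Finitely many finite reasons fit into some \<open>{1..n}\<close>, and the completed
  measure is continuous from below as \<open>n\<close> grows.\<close>

lemma Disj_occ_bound:
  assumes "r \<ge> 1" and A: "\<And>i. i \<in> {1..r} \<Longrightarrow> A i \<in> sets cube_measure"
  shows "Disj_occ r A \<in> sets (completion cube_measure) \<and>
    measure (completion cube_measure) (Disj_occ r A) \<le> (\<Prod>i\<in>{1..r}. measure cube_measure (A i))"
proof
  interpret prob_space cube_measure by (rule prob_space_cube_measure)
  let ?C = "completion cube_measure"
  let ?D = "\<lambda>n. Disj_occ_within {1..n} r A"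
  have D: "?D n \<in> sets ?C" for n
    using assms by (intro Disj_occ_within_measurable) auto
  then show "Disj_occ r A \<in> sets ?C"
    unfolding Disj_occ_conv_within[OF assms(1)] by blast
  have "incseq ?D"
    unfolding incseq_def by (simp add: Disj_occ_within_mono)
  then have "emeasure ?C (Disj_occ r A) = (SUP n. emeasure ?C (?D n))"
    unfolding Disj_occ_conv_within[OF assms(1)] using D by (intro SUP_emeasure_incseq[symmetric]) auto
  also have "\<dots> \<le> (\<Prod>i\<in>{1..r}. emeasure cube_measure (A i))"
    using assms by (intro SUP_least Disj_occ_within_emeasure) auto
  also have "\<dots> = ennreal (\<Prod>i\<in>{1..r}. measure cube_measure (A i))"
    by (simp add: emeasure_eq_measure prod_ennreal)
  finally show "measure ?C (Disj_occ r A) \<le> (\<Prod>i\<in>{1..r}. measure cube_measure (A i))"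
    unfolding measure_def[of ?C] by (intro enn2real_leI) (auto intro: prod_nonneg)
qed

lemma disj_occ_eq_Disj_occ: "A \<box> B = Disj_occ 2 (\<lambda>i. if i = 1 then A else B)"
proof (rule set_eqI)
  fix x
  have two: "{1..2::nat} = {1, 2}" by auto
  show "x \<in> A \<box> B \<longleftrightarrow> x \<in> Disj_occ 2 (\<lambda>i. if i = 1 then A else B)"
  proof
    assume "x \<in> A \<box> B"
    then obtain J K where "J \<subseteq> {1..}" "K \<subseteq> {1..}" "finite J" "finite K" "J \<inter> K = {}"
      "x \<in> [A]\<^bsub>J\<^esub>" "x \<in> [B]\<^bsub>K\<^esub>" unfolding mem_disj_occ_iff by blast
    then show "x \<in> Disj_occ 2 (\<lambda>i. if i = 1 then A else B)"
      unfolding mem_Disj_occ_iff two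
      by (intro exI[of _ "\<lambda>i. if i = 1 then J else K"]) (auto simp: disjoint_family_on_def)
  next
    assume "x \<in> Disj_occ 2 (\<lambda>i. if i = 1 then A else B)"
    then obtain J :: "nat \<Rightarrow> nat set" where "J 1 \<subseteq> {1..} \<and> finite (J 1) \<and> x \<in> [A]\<^bsub>J 1\<^esub>"
      "J 2 \<subseteq> {1..} \<and> finite (J 2) \<and> x \<in> [B]\<^bsub>J 2\<^esub>" "J 1 \<inter> J 2 = {}"
      unfolding mem_Disj_occ_iff two by (auto simp: disjoint_family_on_def)
    then show "x \<in> A \<box> B"
      unfolding mem_disj_occ_iff by (intro exI[of _ "J 1"] exI[of _ "J 2"]) auto
  qed
qed

theorem theorem9:
  "(\<forall>A \<in> sets cube_measure. \<forall>B \<in> sets cube_measure.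
      A \<box> B \<in> sets (completion cube_measure) \<and>
      measure (completion cube_measure) (A \<box> B)
        \<le> measure cube_measure A * measure cube_measure B) \<and>
   (\<forall>r\<ge>2. \<forall>A :: nat \<Rightarrow> (nat \<Rightarrow> real) set. (\<forall>i\<in>{1..r}. A i \<in> sets cube_measure) \<longrightarrow>
      Disj_occ r A \<in> sets (completion cube_measure) \<and>
      measure (completion cube_measure) (Disj_occ r A)
        \<le> (\<Prod>i\<in>{1..r}. measure cube_measure (A i)))"
proof (intro conjI[of "Ball _ _"] ballI allI impI)
  fix A B assume AB: "A \<in> sets cube_measure" "B \<in> sets cube_measure"
  have "(\<Prod>i\<in>{1..2::nat}. measure cube_measure (if i = 1 then A else B)) =
      measure cube_measure A * measure cube_measure B"
    by (simp add: numeral_2_eq_2)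
  then show "A \<box> B \<in> sets (completion cube_measure) \<and>
      measure (completion cube_measure) (A \<box> B) \<le> measure cube_measure A * measure cube_measure B"
    using Disj_occ_bound[of 2 "\<lambda>i. if i = 1 then A else B"] AB
    unfolding disj_occ_eq_Disj_occ by auto
next
  fix r :: nat and A :: "nat \<Rightarrow> (nat \<Rightarrow> real) set"
  assume "r \<ge> 2" "\<forall>i\<in>{1..r}. A i \<in> sets cube_measure"
  then show "Disj_occ r A \<in> sets (completion cube_measure) \<and>
      measure (completion cube_measure) (Disj_occ r A) \<le> (\<Prod>i\<in>{1..r}. measure cube_measure (A i))"
    by (intro Disj_occ_bound) auto
qed

end
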